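(* Let $(\bar u,\bar\lambda)\in X\times\bar\Lambda$ be the unique solution of the mixed problem $$a(\bar u,v)+\langle\bar\lambda,v\rangle_{X',X}=(f,v)_X\ \text{ for all } v\in X,\qquad \langle\bar\mu-\bar\lambda,\bar u\rangle_{X',X}\le 0\ \text{ for all }\bar\mu\in\bar\Lambda.$$ Let $u_0\in X$ be the unique solution of the variational inequality of the second kind $$a(u_0,v-u_0)+j(v)-j(u_0)\ge (f,v-u_0)_X\ \text{ for all } v\in X,$$ and let $\lambda_0\in X'$ be defined by $$\langle\lambda_0,v\rangle_{X',X}=(f,v)_X-a(u_0,v)\ \text{ for all } v\in X.$$ Then $\bar u=u_0$ and $\bar\lambda=\lambda_0$.
   Context: $\Omega\subset\mathbb R^2$ is a bounded domain with smooth boundary $\Gamma$, partitioned into three measurable parts $\Gamma_1,\Gamma_2,\Gamma_3$ of positive measure. $g>0$ and $\xi>0$ are constants, $f_0\in L^2(\Omega)$, $f_2\in L^2(\Gamma_2)$. $\gamma:H^1(\Omega)\to L^2(\Gamma)$ is the trace operator. $X=\{v\in H^1(\Omega)\mid \gamma v=0 \text{ a.e. on }\Gamma_1\}$ is the Hilbert space with inner product $(u,v)_X=(\nabla u,\nabla v)_{L^2(\Omega)^2}$; $X'$ is its dual and $\langle\cdot,\cdot\rangle_{X',X}$ the duality pairing. $a:X\times X\to\mathbb R$, $a(u,v)=\xi(u,v)_X$; $j:X\to\mathbb R$, $j(v)=\int_{\Gamma_3}g|\gamma v|\,d\Gamma$; $f\in X$ is the element defined (via the Riesz representation theorem) by $(f,v)_X=\int_\Omega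 f_0v\,dx+\int_{\Gamma_2}f_2\,\gamma v\,d\Gamma$ for all $v\in X$. $\bar\Lambda=\{\bar\mu\in X'\mid \langle\bar\mu,v\rangle_{X',X}\le\int_{\Gamma_3}g|\gamma v|\,d\Gamma\ \text{ for all }v\in X\}$. Both the mixed problem and the variational inequality in the statement are known to have a unique solution. *)

theory Defs
  imports "HOL-Analysis.Analysis"
begin

section \<open>Length measure on curves\<close>

text \<open>
  One-dimensional Hausdorff measure, which on a smooth curve is arc length. The covering sets are
  required to be bounded because \<^const>\<open>diameter\<close> is meaningless on unbounded sets.
\<close>

definition length_pre :: "real \<Rightarrow> 'a::metric_space set \<Rightarrow> ennreal" where
  "length_pre \<delta> A =
     (INF C \<in> {C :: nat \<Rightarrow> 'a set. A \<subseteq> (\<Union>i. C i) \<and> (\<forall>i. bounded (C i) \<and> diameter (C i) \<le> \<delta>)}.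
        \<Sum>i. ennreal (diameter (C i)))"

definition length_outer :: "'a::metric_space set \<Rightarrow> ennreal" where
  "length_outer A = (SUP \<delta> \<in> {0<..}. length_pre \<delta> A)"

definition length_measure :: "'a::metric_space measure" where
  "length_measure = measure_of UNIV (lambda_system UNIV UNIV length_outer) length_outer"

text \<open>
  \<^const>\<open>measure_of\<close> yields the zero measure unless it is given a genuine measure; the lemmas below
  confirm that this fallback is not taken.
\<close>

lemma length_pre_empty:
  assumes "0 < \<delta>"
  shows "length_pre \<delta> {} = 0"
proof -
  have "length_pre \<delta> ({}::'a set) \<le> (\<Sum>i::nat. ennreal (diameter ({}::'a set)))"
    unfolding length_pre_def using assms
    by (intro INF_lower2[where i = "\<lambda>i::nat. {}::'a set"]) auto
  then show ?thesis by simp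
qed

lemma length_pre_mono: "A \<subseteq> B \<Longrightarrow> length_pre \<delta> A \<le> length_pre \<delta> B"
  unfolding length_pre_def by (rule INF_superset_mono) auto

lemma length_pre_Union:
  fixes A :: "nat \<Rightarrow> 'a::metric_space set"
  shows "length_pre \<delta> (\<Union>i. A i) \<le> (\<Sum>i. length_pre \<delta> (A i))"
proof (rule ennreal_le_epsilon)
  fix e :: real
  assume fin: "(\<Sum>i. length_pre \<delta> (A i)) < top" and e: "0 < e"
  define \<C> where
    "\<C> B = {C :: nat \<Rightarrow> 'a set. B \<subseteq> (\<Union>i. C i) \<and> (\<forall>i. bounded (C i) \<and> diameter (C i) \<le> \<delta>)}" for B
  have "\<exists>C \<in> \<C> (A i). (\<Sum>k. ennreal (diameter (C k))) \<le> length_pre \<delta> (A i) + ennreal (e * (1/2)^Suc i)"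
    for i
  proof -
    have "length_pre \<delta> (A i) < top"
      using fin ennreal_suminf_lessD by blast
    then have "length_pre \<delta> (A i) < length_pre \<delta> (A i) + ennreal (e * (1/2)^Suc i)"
      using e by (cases "length_pre \<delta> (A i)" rule: ennreal_cases)
        (auto simp flip: ennreal_plus simp: ennreal_less_iff)
    then show ?thesis
      unfolding length_pre_def \<C>_def INF_less_iff by (auto intro: less_imp_le)
  qed
  then obtain C where C: "\<And>i. C i \<in> \<C> (A i)"
    and le: "\<And>i. (\<Sum>k. ennreal (diameter (C i k))) \<le> length_pre \<delta> (A i) + ennreal (e * (1/2)^Suc i)"
    by metis
  define D where "D n = (case prod_decode n of (i, k) \<Rightarrow> C i k)" for n
  have "(\<Union>i. A i) \<subseteq> (\<Union>n. D n)"
  proof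
    fix x assume "x \<in> (\<Union>i. A i)"
    then obtain i k where "x \<in> C i k"
      using C unfolding \<C>_def by blast
    then have "x \<in> D (prod_encode (i, k))" by (simp add: D_def)
    then show "x \<in> (\<Union>n. D n)" by blast
  qed
  moreover have "bounded (D n) \<and> diameter (D n) \<le> \<delta>" for n
    using C unfolding \<C>_def D_def by (auto split: prod.split)
  ultimately have "length_pre \<delta> (\<Union>i. A i) \<le> (\<Sum>n. ennreal (diameter (D n)))"
    unfolding length_pre_def by (intro INF_lower) auto
  also have "\<dots> = (\<Sum>n. (case prod_decode n of (i, k) \<Rightarrow> ennreal (diameter (C i k))))"
    by (intro suminf_cong) (auto simp: D_def split: prod.split)
  also have "\<dots> = (\<Sum>i. \<Sum>k. ennreal (diameter (C i k)))"
    by (subst suminf_ennreal_2dimen[where f = "\<lambda>(i, k). ennreal (diameter (C i k))", symmetric])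
       (auto simp: comp_def case_prod_unfold)
  also have "\<dots> \<le> (\<Sum>i. length_pre \<delta> (A i) + ennreal (e * (1/2)^Suc i))"
    by (intro suminf_le le) auto
  also have "\<dots> = (\<Sum>i. length_pre \<delta> (A i)) + (\<Sum>i. ennreal (e * (1/2)^Suc i))"
    by (rule suminf_add[symmetric]) auto
  also have "(\<Sum>i. ennreal (e * (1/2)^Suc i)) = ennreal e"
    using sums_mult[OF power_half_series, of e] e
    by (intro suminf_ennreal_eq) auto
  finally show "length_pre \<delta> (\<Union>i. A i) \<le> (\<Sum>i. length_pre \<delta> (A i)) + ennreal e" .
qed

lemma outer_measure_space_length_outer:
  "outer_measure_space (UNIV :: 'a::metric_space set set) length_outer"
proof -
  have "countably_subadditive UNIV (length_outer :: 'a set \<Rightarrow> ennreal)"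
    unfolding countably_subadditive_def
  proof (intro allI impI)
    fix A :: "nat \<Rightarrow> 'a set"
    show "length_outer (\<Union>i. A i) \<le> (\<Sum>i. length_outer (A i))"
      unfolding length_outer_def[of "\<Union>i. A i"]
    proof (rule SUP_least)
      fix \<delta> :: real assume "\<delta> \<in> {0<..}"
      then have "(\<Sum>i. length_pre \<delta> (A i)) \<le> (\<Sum>i. length_outer (A i))"
        unfolding length_outer_def by (intro suminf_le SUP_upper) auto
      then show "length_pre \<delta> (\<Union>i. A i) \<le> (\<Sum>i. length_outer (A i))"
        using length_pre_Union order_trans by blast
    qed
  qed
  moreover have "positive UNIV (length_outer :: 'a set \<Rightarrow> ennreal)"
    by (auto simp: positive_def length_outer_def length_pre_empty)
  moreover have "increasing UNIV (length_outer :: 'a set \<Rightarrow> ennreal)"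
    unfolding increasing_def length_outer_def by (auto intro!: SUP_mono' length_pre_mono)
  ultimately show ?thesis
    by (simp add: outer_measure_space_def)
qed

lemma measure_space_length_outer:
  "measure_space UNIV (lambda_system UNIV UNIV length_outer)
     (length_outer :: 'a::metric_space set \<Rightarrow> ennreal)"
proof -
  interpret sigma_algebra "UNIV :: 'a set" UNIV
    using sigma_algebra_Pow[of "UNIV :: 'a set"] by simp
  show ?thesis
    using caratheodory_lemma outer_measure_space_length_outer by blast
qed

lemma space_length_measure [simp]: "space length_measure = UNIV"
  by (simp add: length_measure_def space_measure_of_conv)

lemma sets_length_measure: "sets length_measure = lambda_system UNIV UNIV length_outer"
  unfolding length_measure_def
  by (intro sigma_algebra.sets_measure_of_eq measure_space_length_outer[unfolded measure_space_def, THEN conjunct1])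

lemma emeasure_length_measure:
  assumes "A \<in> sets length_measure"
  shows "emeasure length_measure A = length_outer A"
proof -
  have *: "sigma_algebra UNIV (lambda_system UNIV UNIV (length_outer :: 'a set \<Rightarrow> ennreal))"
    "positive (lambda_system UNIV UNIV length_outer) (length_outer :: 'a set \<Rightarrow> ennreal)"
    "countably_additive (lambda_system UNIV UNIV length_outer) (length_outer :: 'a set \<Rightarrow> ennreal)"
    using measure_space_length_outer[where 'a='a] by (auto simp: measure_space_def)
  show ?thesis
    unfolding length_measure_def
    by (rule emeasure_measure_of_sigma[OF * assms[unfolded sets_length_measure]])
qed


section \<open>Smooth functions and domains with smooth boundary\<close>

primrec cont_diff :: "nat \<Rightarrow> ('a::euclidean_space \<Rightarrow> real) \<Rightarrow> bool" where
  "cont_diff 0 f \<longleftrightarrow> continuous_on UNIV f"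
| "cont_diff (Suc k) f \<longleftrightarrow>
     f differentiable_on UNIV \<and> (\<forall>b\<in>Basis. cont_diff k (\<lambda>x. frechet_derivative f (at x) b))"

definition smooth :: "('a::euclidean_space \<Rightarrow> real) \<Rightarrow> bool" where
  "smooth f \<longleftrightarrow> (\<forall>k. cont_diff k f)"

text \<open>
  Near each boundary point, after an orthogonal change of coordinates, the set is the region
  strictly above the graph of a smooth function.
\<close>

definition smooth_boundary :: "(real^2) set \<Rightarrow> bool" where
  "smooth_boundary \<Omega> \<longleftrightarrow>
     (\<forall>p \<in> frontier \<Omega>. \<exists>r>0. \<exists>(T :: real^2 \<Rightarrow> real^2) (h :: real \<Rightarrow> real). orthogonal_transformation T \<and> smooth h \<and>
        (\<forall>y \<in> ball p r. y \<in> \<Omega> \<longleftrightarrow> h (T y $ 1) < T y $ 2))"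

definition smooth_bounded_domain :: "(real^2) set \<Rightarrow> bool" where
  "smooth_bounded_domain \<Omega> \<longleftrightarrow>
     open \<Omega> \<and> connected \<Omega> \<and> \<Omega> \<noteq> {} \<and> bounded \<Omega> \<and> smooth_boundary \<Omega>"


section \<open>Lebesgue and Sobolev spaces\<close>

text \<open>
  Elements of the function spaces are represented by functions; two functions represent the same
  element iff they agree almost everywhere on the domain.
\<close>

definition L2 :: "'a measure \<Rightarrow> ('a \<Rightarrow> real) set" where
  "L2 M = {u \<in> borel_measurable M. integrable M (\<lambda>x. (u x)\<^sup>2)}"

definition L2_norm :: "'a measure \<Rightarrow> ('a \<Rightarrow> real) \<Rightarrow> real" where
  "L2_norm M u = sqrt (\<integral>x. (u x)\<^sup>2 \<partial>M)"

definition test_functions :: "'a::euclidean_space set \<Rightarrow> ('a \<Rightarrow> real) set" where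
  "test_functions \<Omega> =
     {\<phi>. smooth \<phi> \<and> compact (closure {x. \<phi> x \<noteq> 0}) \<and> closure {x. \<phi> x \<noteq> 0} \<subseteq> \<Omega>}"

definition is_weak_gradient ::
    "'a::euclidean_space set \<Rightarrow> ('a \<Rightarrow> real) \<Rightarrow> ('a \<Rightarrow> 'a) \<Rightarrow> bool" where
  "is_weak_gradient \<Omega> u G \<longleftrightarrow>
     (\<forall>b\<in>Basis. (\<lambda>x. G x \<bullet> b) \<in> L2 (lebesgue_on \<Omega>)) \<and>
     (\<forall>\<phi>\<in>test_functions \<Omega>. \<forall>b\<in>Basis.
        (\<integral>x. u x * frechet_derivative \<phi> (at x) b \<partial>lebesgue_on \<Omega>) =
        - (\<integral>x. (G x \<bullet> b) * \<phi> x \<partial>lebesgue_on \<Omega>))"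

definition H1 :: "'a::euclidean_space set \<Rightarrow> ('a \<Rightarrow> real) set" where
  "H1 \<Omega> = {u \<in> L2 (lebesgue_on \<Omega>). \<exists>G. is_weak_gradient \<Omega> u G}"

text \<open>The weak gradient is determined only up to null sets; an arbitrary representative is chosen.\<close>

definition weak_gradient :: "'a::euclidean_space set \<Rightarrow> ('a \<Rightarrow> real) \<Rightarrow> 'a \<Rightarrow> 'a" where
  "weak_gradient \<Omega> u = (SOME G. is_weak_gradient \<Omega> u G)"

definition grad_inner :: "'a::euclidean_space set \<Rightarrow> ('a \<Rightarrow> real) \<Rightarrow> ('a \<Rightarrow> real) \<Rightarrow> real" where
  "grad_inner \<Omega> u v = (\<integral>x. weak_gradient \<Omega> u x \<bullet> weak_gradient \<Omega> v x \<partial>lebesgue_on \<Omega>)"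

definition H1_norm :: "'a::euclidean_space set \<Rightarrow> ('a \<Rightarrow> real) \<Rightarrow> real" where
  "H1_norm \<Omega> u = sqrt ((\<integral>x. (u x)\<^sup>2 \<partial>lebesgue_on \<Omega>) + grad_inner \<Omega> u u)"

text \<open>
  \<open>boundary_on A\<close> is the length measure on a part \<open>A\<close> of the boundary curve.
  The trace operator is the bounded linear operator from \<open>H1 \<Omega>\<close> to \<open>L2\<close> of the boundary that
  restricts functions continuous up to the boundary. Since \<open>H1 \<Omega>\<close> consists of representatives,
  linearity and the restriction property hold almost everywhere; linearity and boundedness
  together force functions that agree almost everywhere on \<open>\<Omega>\<close> to have the same trace.
\<close>

definition boundary_on :: "(real^2) set \<Rightarrow> (real^2) measure" where
  "boundary_on A = restrict_space length_measure A"

definition trace_operator ::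
    "(real^2) set \<Rightarrow> ((real^2 \<Rightarrow> real) \<Rightarrow> (real^2 \<Rightarrow> real)) \<Rightarrow> bool" where
  "trace_operator \<Omega> \<gamma> \<longleftrightarrow>
     (\<forall>u\<in>H1 \<Omega>. \<gamma> u \<in> L2 (boundary_on (frontier \<Omega>))) \<and>
     (\<forall>u\<in>H1 \<Omega>. \<forall>v\<in>H1 \<Omega>. \<forall>a b.
        AE x in boundary_on (frontier \<Omega>).
          \<gamma> (\<lambda>y. a * u y + b * v y) x = a * \<gamma> u x + b * \<gamma> v x) \<and>
     (\<exists>C. \<forall>u\<in>H1 \<Omega>. L2_norm (boundary_on (frontier \<Omega>)) (\<gamma> u) \<le> C * H1_norm \<Omega> u) \<and>
     (\<forall>u\<in>H1 \<Omega>. continuous_on (closure \<Omega>) u \<longrightarrow>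
        (AE x in boundary_on (frontier \<Omega>). \<gamma> u x = u x))"


section \<open>Data of the mixed problem and of the variational inequality\<close>

definition boundary_partition ::
    "(real^2) set \<Rightarrow> (real^2) set \<Rightarrow> (real^2) set \<Rightarrow> (real^2) set \<Rightarrow> bool" where
  "boundary_partition \<Gamma> \<Gamma>\<^sub>1 \<Gamma>\<^sub>2 \<Gamma>\<^sub>3 \<longleftrightarrow>
     \<Gamma> = \<Gamma>\<^sub>1 \<union> \<Gamma>\<^sub>2 \<union> \<Gamma>\<^sub>3 \<and> \<Gamma>\<^sub>1 \<inter> \<Gamma>\<^sub>2 = {} \<and> \<Gamma>\<^sub>1 \<inter> \<Gamma>\<^sub>3 = {} \<and> \<Gamma>\<^sub>2 \<inter> \<Gamma>\<^sub>3 = {} \<and>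
     (\<forall>A \<in> {\<Gamma>\<^sub>1, \<Gamma>\<^sub>2, \<Gamma>\<^sub>3}. A \<in> sets length_measure \<and> emeasure length_measure A > 0)"

definition space_X ::
    "(real^2) set \<Rightarrow> ((real^2 \<Rightarrow> real) \<Rightarrow> (real^2 \<Rightarrow> real)) \<Rightarrow> (real^2) set \<Rightarrow> (real^2 \<Rightarrow> real) set" where
  "space_X \<Omega> \<gamma> \<Gamma>\<^sub>1 = {v \<in> H1 \<Omega>. AE x in boundary_on \<Gamma>\<^sub>1. \<gamma> v x = 0}"

text \<open>
  Functionals are total functions of which only the values on the space matter, so two functionals
  are equal in the dual iff they agree on the space. The duality pairing is application.
\<close>

definition dual_X ::
    "(real^2) set \<Rightarrow> ((real^2 \<Rightarrow> real) \<Rightarrow> (real^2 \<Rightarrow> real)) \<Rightarrow> (real^2) set \<Rightarrow>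
     ((real^2 \<Rightarrow> real) \<Rightarrow> real) set" where
  "dual_X \<Omega> \<gamma> \<Gamma>\<^sub>1 =
     {F. (\<forall>u\<in>space_X \<Omega> \<gamma> \<Gamma>\<^sub>1. \<forall>v\<in>space_X \<Omega> \<gamma> \<Gamma>\<^sub>1. \<forall>a b.
            F (\<lambda>x. a * u x + b * v x) = a * F u + b * F v) \<and>
         (\<exists>C. \<forall>v\<in>space_X \<Omega> \<gamma> \<Gamma>\<^sub>1. \<bar>F v\<bar> \<le> C * sqrt (grad_inner \<Omega> v v))}"

definition form_a :: "(real^2) set \<Rightarrow> real \<Rightarrow> (real^2 \<Rightarrow> real) \<Rightarrow> (real^2 \<Rightarrow> real) \<Rightarrow> real" where
  "form_a \<Omega> \<xi> u v = \<xi> * grad_inner \<Omega> u v"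

definition func_j ::
    "((real^2 \<Rightarrow> real) \<Rightarrow> (real^2 \<Rightarrow> real)) \<Rightarrow> (real^2) set \<Rightarrow> real \<Rightarrow> (real^2 \<Rightarrow> real) \<Rightarrow> real" where
  "func_j \<gamma> \<Gamma>\<^sub>3 g v = (\<integral>x. g * \<bar>\<gamma> v x\<bar> \<partial>boundary_on \<Gamma>\<^sub>3)"

definition Lambda_bar ::
    "(real^2) set \<Rightarrow> ((real^2 \<Rightarrow> real) \<Rightarrow> (real^2 \<Rightarrow> real)) \<Rightarrow> (real^2) set \<Rightarrow> (real^2) set \<Rightarrow> real \<Rightarrow>
     ((real^2 \<Rightarrow> real) \<Rightarrow> real) set" where
  "Lambda_bar \<Omega> \<gamma> \<Gamma>\<^sub>1 \<Gamma>\<^sub>3 g =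
     {\<mu> \<in> dual_X \<Omega> \<gamma> \<Gamma>\<^sub>1. \<forall>v\<in>space_X \<Omega> \<gamma> \<Gamma>\<^sub>1. \<mu> v \<le> (\<integral>x. g * \<bar>\<gamma> v x\<bar> \<partial>boundary_on \<Gamma>\<^sub>3)}"

end

theory Submission
  imports Defs
begin

text \<open>
  In terms of $\lambda_0 = (f,\cdot)_X - a(u_0,\cdot)$ the variational inequality reads
  $\langle\lambda_0, v - u_0\rangle \le j(v) - j(u_0)$. As $j$ is positively homogeneous, this says that
  $\lambda_0 \in \bar\Lambda$ and $\langle\lambda_0,u_0\rangle = j(u_0)$
  (\<open>variational_multiplier\<close>). Hence $\lambda_0$ may be used as a test element in the mixed problem, which
  gives $\langle\lambda_0 - \bar\lambda, \bar u\rangle \le 0$, while $\bar\lambda \in \bar\Lambda$ gives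
  $\langle\bar\lambda, u_0\rangle \le j(u_0) = \langle\lambda_0,u_0\rangle$. Subtracting the two
  definitions of the multipliers, with $w = \bar u - u_0$,
  \[ a(w,w) = \langle\lambda_0 - \bar\lambda, w\rangle
     = \langle\lambda_0 - \bar\lambda, \bar u\rangle + \langle\bar\lambda - \lambda_0, u_0\rangle \le 0. \]
  So the gradient of $w$ vanishes, $w = 0$, and $\lambda_0 - \bar\lambda = a(w,\cdot) = 0$.

  The argument uses that the gradient inner product is linear in its first argument and definite
  on $X$. Since the weak gradient is an arbitrarily chosen representative, linearity rests on
  uniqueness of weak gradients up to null sets (\<open>weak_gradient_unique\<close>), and thus on the
  fundamental lemma of the calculus of variations (\<open>fundamental_lemma_calculus_of_variations\<close>)
  together with a sufficient supply of test functions (\<open>indicator_open_limit_test_functions\<close>).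

  Definiteness (\<open>space_X_zero_gradient_imp_zero\<close>) has two ingredients. A function with zero weak
  gradient on a connected open set is constant a.e. (\<open>zero_weak_gradient_constant\<close>): it is invariant
  under small translations, which by Fubini makes it locally constant. And the trace of such a
  function is the same constant, which must be zero because $\Gamma_1$ has positive length.
\<close>

section \<open>A smooth function that is flat at the origin\<close>

text \<open>
  With \<open>p = 1\<close> this is the classical $C^\infty$ function $e^{-1/t}$, extended by zero to $t \le 0$. The
  polynomial factor makes the family closed under differentiation, so that smoothness of all its
  members follows by one induction.
\<close>

definition flat :: "real poly \<Rightarrow> real \<Rightarrow> real" where
  "flat p t = (if t > 0 then poly p (1 / t) * exp (- 1 / t) else 0)"

lemma poly_times_exp_minus_tendsto_0:
  "((\<lambda>y::real. poly p y * exp (- y)) \<longlongrightarrow> 0) at_top"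
proof -
  have "((\<lambda>y. \<Sum>i\<le>degree p. coeff p i * (y ^ i / exp y)) \<longlongrightarrow> (\<Sum>i\<le>degree p. coeff p i * 0)) at_top"
    by (intro tendsto_sum tendsto_mult tendsto_const tendsto_power_div_exp_0)
  moreover have "(\<lambda>y. \<Sum>i\<le>degree p. coeff p i * (y ^ i / exp y)) = (\<lambda>y. poly p y * exp (- y))"
    by (simp add: poly_altdef sum_distrib_right exp_minus divide_inverse mult.assoc)
  ultimately show ?thesis by simp
qed

lemma flat_tendsto_0: "(flat p \<longlongrightarrow> 0) (at 0)"
proof -
  have "((\<lambda>t. poly p (inverse t) * exp (- inverse t)) \<longlongrightarrow> 0) (at_right 0)"
    using poly_times_exp_minus_tendsto_0 filterlim_inverse_at_top_right
    by (rule filterlim_compose)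
  moreover have "\<forall>\<^sub>F t in at_right 0. poly p (inverse t) * exp (- inverse t) = flat p t"
    unfolding eventually_at_right_field
    by (intro exI[of _ 1]) (auto simp: flat_def inverse_eq_divide)
  ultimately have "(flat p \<longlongrightarrow> 0) (at_right 0)"
    by (rule Lim_transform_eventually)
  moreover have "\<forall>\<^sub>F t in at_left 0. 0 = flat p t"
    unfolding eventually_at_left_field
    by (intro exI[of _ "-1"]) (auto simp: flat_def)
  then have "(flat p \<longlongrightarrow> 0) (at_left 0)"
    by (rule Lim_transform_eventually[OF tendsto_const])
  ultimately show ?thesis
    by (simp add: filterlim_split_at)
qed

text \<open>
  Away from the origin this is the product rule. At the origin the difference quotient is
  $p(1/h)\,e^{-1/h}/h$, which is again a member of the family (for the polynomial $X p$) and therefore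
  tends to zero.
\<close>

lemma has_real_derivative_flat:
  "(flat p has_real_derivative flat ([:0, 0, 1:] * (p - pderiv p)) t) (at t)"
proof -
  consider "t > 0" | "t < 0" | "t = 0" by linarith
  then show ?thesis
  proof cases
    case 1
    have "((\<lambda>t. poly p (1 / t) * exp (- 1 / t)) has_real_derivative
        flat ([:0, 0, 1:] * (p - pderiv p)) t) (at t)"
      using 1 by (auto intro!: derivative_eq_intros DERIV_chain2[OF poly_DERIV]
        simp: flat_def field_simps power2_eq_square)
    then show ?thesis
      by (rule has_field_derivative_transform_within[where d = t])
        (use 1 in \<open>auto simp: flat_def dist_real_def\<close>)
  next
    case 2
    have "((\<lambda>t. 0) has_real_derivative 0) (at t)" by simp
    then have "(flat p has_real_derivative 0) (at t)"
      by (rule has_field_derivative_transform_within[where d = "- t"])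
        (use 2 in \<open>auto simp: flat_def dist_real_def\<close>)
    then show ?thesis using 2 by (simp add: flat_def)
  next
    case 3
    have "flat p h / h = flat ([:0, 1:] * p) h" for h
      by (simp add: flat_def)
    then have "((\<lambda>h. flat p h / h) \<longlongrightarrow> 0) (at 0)"
      using flat_tendsto_0 by simp
    then show ?thesis using 3 by (simp add: DERIV_def flat_def)
  qed
qed

section \<open>Closure properties of smooth functions\<close>

lemma cont_diff_Suc_has_derivative:
  assumes "cont_diff (Suc k) f"
  shows "(f has_derivative frechet_derivative f (at x)) (at x)"
  using assms by (auto simp: differentiable_on_def frechet_derivative_works)

lemma cont_diff_SucI:
  assumes "\<And>x. (f has_derivative D x) (at x)"
    and "\<And>b. b \<in> Basis \<Longrightarrow> cont_diff k (\<lambda>x. D x b)"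
  shows "cont_diff (Suc k) f"
proof -
  have "frechet_derivative f (at x) = D x" for x
    using frechet_derivative_at[OF assms(1)] by simp
  then show ?thesis
    using assms by (auto simp: differentiable_on_def differentiable_def intro: has_derivative_at_withinI)
qed

lemma cont_diff_SucD: "cont_diff (Suc k) f \<Longrightarrow> cont_diff k f"
proof (induction k arbitrary: f)
  case 0
  then show ?case by (auto intro: differentiable_imp_continuous_on)
next
  case (Suc k)
  show ?case
  proof (rule cont_diff_SucI)
    show "(f has_derivative frechet_derivative f (at x)) (at x)" for x
      using Suc.prems by (rule cont_diff_Suc_has_derivative)
    show "cont_diff k (\<lambda>x. frechet_derivative f (at x) b)" if "b \<in> Basis" for b
      using Suc.prems that by (intro Suc.IH) simp
  qed
qed

lemma cont_diff_const: "cont_diff k (\<lambda>x. c)"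
proof (induction k arbitrary: c)
  case (Suc k)
  show ?case
    by (rule cont_diff_SucI[where D = "\<lambda>x v. 0"]) (auto intro: Suc)
qed auto

lemma cont_diff_inner: "cont_diff k (\<lambda>x. x \<bullet> c)"
proof (cases k)
  case (Suc k')
  show ?thesis unfolding Suc
    by (rule cont_diff_SucI[where D = "\<lambda>x v. v \<bullet> c"])
      (auto intro!: derivative_eq_intros cont_diff_const)
qed (auto intro!: continuous_intros)

lemma cont_diff_add: "cont_diff k f \<Longrightarrow> cont_diff k g \<Longrightarrow> cont_diff k (\<lambda>x. f x + g x)"
proof (induction k arbitrary: f g)
  case (Suc k)
  show ?case
  proof (rule cont_diff_SucI)
    show "((\<lambda>x. f x + g x) has_derivative
      (\<lambda>v. frechet_derivative f (at x) v + frechet_derivative g (at x) v)) (at x)" for x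
      by (intro has_derivative_add Suc.prems[THEN cont_diff_Suc_has_derivative])
  qed (use Suc in auto)
qed (auto intro: continuous_intros)

lemma cont_diff_mult: "cont_diff k f \<Longrightarrow> cont_diff k g \<Longrightarrow> cont_diff k (\<lambda>x. f x * g x)"
proof (induction k arbitrary: f g)
  case (Suc k)
  show ?case
  proof (rule cont_diff_SucI)
    show "((\<lambda>x. f x * g x) has_derivative
      (\<lambda>v. f x * frechet_derivative g (at x) v + frechet_derivative f (at x) v * g x)) (at x)" for x
      by (intro has_derivative_mult Suc.prems[THEN cont_diff_Suc_has_derivative])
    show "cont_diff k (\<lambda>x. f x * frechet_derivative g (at x) b + frechet_derivative f (at x) b * g x)"
      if "b \<in> Basis" for b
      using Suc.prems that
      by (intro cont_diff_add Suc.IH cont_diff_SucD[OF Suc.prems(1)] cont_diff_SucD[OF Suc.prems(2)]) auto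
  qed
qed (auto intro: continuous_intros)

lemma cont_diff_sum:
  "(\<And>i. i \<in> I \<Longrightarrow> cont_diff k (f i)) \<Longrightarrow> cont_diff k (\<lambda>x. \<Sum>i\<in>I. f i x)"
  by (induction I rule: infinite_finite_induct) (auto intro: cont_diff_const cont_diff_add)

text \<open>
  The chain rule yields a product of the derivative of \<open>f\<close> with another member of the family
  \<open>flat\<close>; hence the induction over the order has to generalise over the polynomial.
\<close>

lemma cont_diff_flat: "cont_diff k f \<Longrightarrow> cont_diff k (\<lambda>x. flat p (f x))"
proof (induction k arbitrary: p)
  case 0
  have "continuous_on UNIV (flat p)"
    using has_real_derivative_flat DERIV_isCont by (intro continuous_at_imp_continuous_on) blast
  then show ?case
    using 0 by (auto intro: continuous_on_compose2)
next
  case (Suc k)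
  let ?q = "[:0, 0, 1:] * (p - pderiv p)"
  show ?case
  proof (rule cont_diff_SucI)
    show "((\<lambda>x. flat p (f x)) has_derivative (\<lambda>v. flat ?q (f x) * frechet_derivative f (at x) v)) (at x)"
      for x
      using has_derivative_compose[OF cont_diff_Suc_has_derivative[OF Suc.prems]
        has_real_derivative_flat[unfolded has_field_derivative_def]] by simp
    show "cont_diff k (\<lambda>x. flat ?q (f x) * frechet_derivative f (at x) b)" if "b \<in> Basis" for b
      using Suc.prems that by (intro cont_diff_mult Suc.IH cont_diff_SucD[OF Suc.prems]) auto
  qed
qed

lemma cont_diff_shift: "cont_diff k f \<Longrightarrow> cont_diff k (\<lambda>x. f (x + h))"
proof (induction k arbitrary: f)
  case 0
  then show ?case by (auto intro!: continuous_on_compose2[of UNIV f] continuous_intros)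
next
  case (Suc k)
  show ?case
  proof (rule cont_diff_SucI)
    show "((\<lambda>x. f (x + h)) has_derivative frechet_derivative f (at (x + h))) (at x)" for x
    proof -
      have "((\<lambda>x. x + h) has_derivative (\<lambda>v. v)) (at x)"
        by (auto intro!: derivative_eq_intros)
      from has_derivative_compose[OF this cont_diff_Suc_has_derivative[OF Suc.prems]]
      show ?thesis .
    qed
  qed (use Suc in auto)
qed

section \<open>Test functions\<close>

lemma test_functionsI:
  assumes "smooth \<phi>" and "compact K" and "K \<subseteq> \<Omega>" and "\<And>x. x \<notin> K \<Longrightarrow> \<phi> x = 0"
  shows "\<phi> \<in> test_functions \<Omega>"
proof -
  have "closure {x. \<phi> x \<noteq> 0} \<subseteq> K"
    using assms compact_imp_closed by (intro closure_minimal) auto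
  moreover have "compact (closure {x. \<phi> x \<noteq> 0})"
    using compact_Int_closed[OF assms(2) closed_closure[of "{x. \<phi> x \<noteq> 0}"]] calculation
    by (simp add: Int_absorb1)
  ultimately show ?thesis
    using assms by (auto simp: test_functions_def)
qed

lemma test_functions_mono: "\<phi> \<in> test_functions V \<Longrightarrow> V \<subseteq> \<Omega> \<Longrightarrow> \<phi> \<in> test_functions \<Omega>"
  by (auto simp: test_functions_def)

lemma test_function_smooth: "\<phi> \<in> test_functions \<Omega> \<Longrightarrow> smooth \<phi>"
  by (simp add: test_functions_def)

lemma test_function_has_derivative:
  "\<phi> \<in> test_functions \<Omega> \<Longrightarrow> (\<phi> has_derivative frechet_derivative \<phi> (at x)) (at x)"
  by (rule cont_diff_Suc_has_derivative) (metis smooth_def test_function_smooth)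

lemma test_function_continuous: "\<phi> \<in> test_functions \<Omega> \<Longrightarrow> continuous_on UNIV \<phi>"
  using test_function_smooth smooth_def cont_diff.simps(1) by blast

lemma test_function_measurable: "\<phi> \<in> test_functions \<Omega> \<Longrightarrow> \<phi> \<in> borel_measurable borel"
  by (intro borel_measurable_continuous_onI test_function_continuous)

lemma test_function_bounded:
  assumes "\<phi> \<in> test_functions \<Omega>"
  obtains C where "\<And>x. \<bar>\<phi> x\<bar> \<le> C"
proof -
  let ?K = "closure {x. \<phi> x \<noteq> 0}"
  have "compact (\<phi> ` ?K)"
    using assms by (intro compact_continuous_image continuous_on_subset[OF test_function_continuous])
      (auto simp: test_functions_def)
  then obtain C where C: "\<And>y. y \<in> \<phi> ` ?K \<Longrightarrow> \<bar>y\<bar> \<le> C"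
    using compact_imp_bounded bounded_real by metis
  have "\<bar>\<phi> x\<bar> \<le> max 0 C" for x
  proof (cases "\<phi> x = 0")
    case False
    then have "x \<in> ?K" using closure_subset[of "{x. \<phi> x \<noteq> 0}"] by auto
    then have "\<phi> x \<in> \<phi> ` ?K" by blast
    then show ?thesis using C by fastforce
  qed auto
  then show ?thesis by (rule that)
qed

text \<open>
  Outside the closed support the function vanishes on a neighbourhood, so the support does not grow
  under differentiation.
\<close>

lemma test_function_derivative:
  assumes "\<phi> \<in> test_functions \<Omega>" and "b \<in> Basis"
  shows "(\<lambda>x. frechet_derivative \<phi> (at x) b) \<in> test_functions \<Omega>"
proof (rule test_functionsI)
  let ?K = "closure {x. \<phi> x \<noteq> 0}"
  show "smooth (\<lambda>x. frechet_derivative \<phi> (at x) b)"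
    unfolding smooth_def
  proof
    fix k
    have "cont_diff (Suc k) \<phi>" using test_function_smooth[OF assms(1)] unfolding smooth_def ..
    then show "cont_diff k (\<lambda>x. frechet_derivative \<phi> (at x) b)" using assms(2) by simp
  qed
  show "compact ?K" "?K \<subseteq> \<Omega>" using assms by (auto simp: test_functions_def)
  show "frechet_derivative \<phi> (at x) b = 0" if "x \<notin> ?K" for x
  proof -
    have "(\<phi> has_derivative (\<lambda>v. 0)) (at x)"
    proof (rule has_derivative_transform_within_open[where f = "\<lambda>x. 0"])
      show "open (- ?K)" by auto
      show "0 = \<phi> y" if "y \<in> - ?K" for y
        using that closure_subset[of "{x. \<phi> x \<noteq> 0}"] by auto
    qed (use that in auto)
    then show ?thesis
      by (simp add: frechet_derivative_at[symmetric])
  qed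
qed

lemma test_function_shift:
  assumes \<phi>: "\<phi> \<in> test_functions V" and "\<And>x. x \<in> V \<Longrightarrow> x - h \<in> \<Omega>"
  shows "(\<lambda>x. \<phi> (x + h)) \<in> test_functions \<Omega>"
proof (rule test_functionsI)
  let ?K = "closure {x. \<phi> x \<noteq> 0}"
  show "smooth (\<lambda>x. \<phi> (x + h))"
    using test_function_smooth[OF \<phi>] by (auto simp: smooth_def intro: cont_diff_shift)
  show "compact ((\<lambda>x. x - h) ` ?K)"
    using \<phi> by (intro compact_continuous_image continuous_intros) (auto simp: test_functions_def)
  show "(\<lambda>x. x - h) ` ?K \<subseteq> \<Omega>"
    using assms by (auto simp: test_functions_def)
  show "\<phi> (x + h) = 0" if "x \<notin> (\<lambda>x. x - h) ` ?K" for x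
  proof (rule ccontr)
    assume "\<phi> (x + h) \<noteq> 0"
    then have "x + h \<in> ?K" using closure_subset[of "{x. \<phi> x \<noteq> 0}"] by auto
    then show False using that by force
  qed
qed

definition bump :: "'a::euclidean_space \<Rightarrow> real \<Rightarrow> 'a \<Rightarrow> real" where
  "bump p r x = flat 1 (r\<^sup>2 - (x - p) \<bullet> (x - p))"

lemma flat_one_bounds: "0 \<le> flat 1 t" "flat 1 t \<le> 1"
  by (auto simp: flat_def)

lemma bump_pos_iff:
  assumes "r > 0" shows "bump p r x > 0 \<longleftrightarrow> x \<in> ball p r"
proof -
  have "bump p r x > 0 \<longleftrightarrow> (norm (x - p))\<^sup>2 < r\<^sup>2"
    by (auto simp: bump_def flat_def dot_square_norm)
  also have "\<dots> \<longleftrightarrow> norm (x - p) < r"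
    using assms by (simp add: abs_le_square_iff not_le[symmetric])
  finally show ?thesis
    by (simp add: dist_norm norm_minus_commute)
qed

lemma smooth_bump: "smooth (bump p r)"
  unfolding smooth_def
proof
  fix k
  have "cont_diff k (\<lambda>x. r\<^sup>2 + (- 1) * (\<Sum>b\<in>Basis. (x \<bullet> b + (- p \<bullet> b)) * (x \<bullet> b + (- p \<bullet> b))))"
    by (intro cont_diff_add cont_diff_mult cont_diff_sum cont_diff_const cont_diff_inner)
  moreover have "(\<lambda>x. r\<^sup>2 + (- 1) * (\<Sum>b\<in>Basis. (x \<bullet> b + (- p \<bullet> b)) * (x \<bullet> b + (- p \<bullet> b))))
      = (\<lambda>x. r\<^sup>2 - (x - p) \<bullet> (x - p))"
    by (subst euclidean_inner) (auto simp: inner_diff_left)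
  ultimately show "cont_diff k (bump p r)"
    unfolding bump_def by (auto intro: cont_diff_flat)
qed

text \<open>
  By Lindelof, \<open>V\<close> is a countable union of balls whose closures lie in \<open>V\<close>. The partial sums
  $\psi_n$ of the corresponding bumps have compact support in \<open>V\<close>, and each point of \<open>V\<close> is seen by one
  of the bumps. Rescaling by $n$ sends $\psi_n$ to infinity there, while the outer function $e^{-1/t}$
  keeps the values in $[0,1]$ and sends infinity to $1$.
\<close>

lemma indicator_open_limit_test_functions:
  fixes V :: "'a::euclidean_space set"
  assumes "open V"
  obtains \<phi> :: "nat \<Rightarrow> 'a \<Rightarrow> real"
  where "\<And>n. \<phi> n \<in> test_functions V" and "\<And>n x. 0 \<le> \<phi> n x" and "\<And>n x. \<phi> n x \<le> 1"
    and "\<And>x. (\<lambda>n. \<phi> n x) \<longlonglongrightarrow> indicator V x"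
proof -
  define F where "F = {ball p r |p r. 0 < r \<and> cball p r \<subseteq> V}"
  obtain F' where F': "F' \<subseteq> F" "countable F'" "\<Union>F' = \<Union>F"
    using Lindelof[of F] by (auto simp: F_def)
  have VF: "\<Union>F = V"
  proof
    show "\<Union>F \<subseteq> V" unfolding F_def using ball_subset_cball by blast
    show "V \<subseteq> \<Union>F"
    proof
      fix x assume "x \<in> V"
      then obtain r where "r > 0" "cball x r \<subseteq> V"
        using assms open_contains_cball by blast
      then show "x \<in> \<Union>F" unfolding F_def using centre_in_ball[of x r] by blast
    qed
  qed
  show ?thesis
  proof (cases "V = {}")
    case True
    show ?thesis
      by (rule that[of "\<lambda>n x. 0"])
        (auto intro!: test_functionsI[of _ "{}"] simp: True smooth_def cont_diff_const)
  next
    case False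
    then have "F' \<noteq> {}" using F' VF by auto
    then have ran: "range (from_nat_into F') = F'"
      using F' by (simp add: range_from_nat_into)
    have "\<forall>i. \<exists>p r. from_nat_into F' i = ball p r \<and> 0 < r \<and> cball p r \<subseteq> V"
    proof
      fix i
      have "from_nat_into F' i \<in> F" using ran F'(1) by blast
      then show "\<exists>p r. from_nat_into F' i = ball p r \<and> 0 < r \<and> cball p r \<subseteq> V"
        unfolding F_def by blast
    qed
    then obtain p r where pr: "\<And>i. from_nat_into F' i = ball (p i) (r i)" "\<And>i. 0 < r i"
      "\<And>i. cball (p i) (r i) \<subseteq> V" by metis
    define \<psi> where "\<psi> n x = (\<Sum>i<n. bump (p i) (r i) x)" for n :: nat and x
    have nonneg: "0 \<le> bump (p i) (r i) x" for i x
      by (simp add: bump_def flat_one_bounds)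
    have pos_iff: "bump (p i) (r i) x > 0 \<longleftrightarrow> x \<in> ball (p i) (r i)" for i x
      by (rule bump_pos_iff) (rule pr(2))
    define \<phi> where "\<phi> n x = flat 1 (real n * \<psi> n x)" for n x
    show ?thesis
    proof (rule that[of \<phi>])
      fix n x
      show "0 \<le> \<phi> n x" by (simp add: \<phi>_def flat_one_bounds)
    next
      fix n x
      show "\<phi> n x \<le> 1" by (simp add: \<phi>_def flat_one_bounds)
    next
      fix n
      show "\<phi> n \<in> test_functions V"
      proof (rule test_functionsI)
        show "smooth (\<phi> n)"
          unfolding \<phi>_def \<psi>_def smooth_def using smooth_bump[unfolded smooth_def]
          by (auto intro!: cont_diff_flat cont_diff_mult cont_diff_const cont_diff_sum)
        show "compact (\<Union>i<n. cball (p i) (r i))" by auto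
        show "(\<Union>i<n. cball (p i) (r i)) \<subseteq> V" using pr(3) by blast
        fix x assume x: "x \<notin> (\<Union>i<n. cball (p i) (r i))"
        have "bump (p i) (r i) x = 0" if "i < n" for i
          using x that pos_iff[of i x] nonneg[of i x] by fastforce
        then show "\<phi> n x = 0" by (simp add: \<phi>_def \<psi>_def flat_def)
      qed
    next
      fix x
      show "(\<lambda>n. \<phi> n x) \<longlonglongrightarrow> indicator V x"
      proof (cases "x \<in> V")
        case True
        then obtain i where i: "x \<in> ball (p i) (r i)"
          using F' VF ran pr by (metis UnionE rangeE)
        define d where "d = bump (p i) (r i) x"
        have d: "d > 0" using i pos_iff by (simp add: d_def)
        have le: "d \<le> \<psi> n x" if "n \<ge> Suc i" for n
          unfolding \<psi>_def d_def using that nonneg by (intro member_le_sum) auto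
        have "(\<lambda>n. exp (- (1 / d) * inverse (real n))) \<longlonglongrightarrow> exp (- (1 / d) * 0)"
          by (intro tendsto_intros lim_inverse_n)
        then have lim: "(\<lambda>n. exp (- (1 / d) * inverse (real n))) \<longlonglongrightarrow> 1" by simp
        have "\<forall>\<^sub>F n in sequentially. exp (- (1 / d) * inverse (real n)) \<le> \<phi> n x"
        proof (rule eventually_sequentiallyI)
          fix n assume n: "n \<ge> Suc i"
          have "0 < real n * d" "real n * d \<le> real n * \<psi> n x"
            using n d le[OF n] by auto
          then have "- (1 / d) * inverse (real n) \<le> - 1 / (real n * \<psi> n x)"
            using n d by (simp add: divide_simps)
          then show "exp (- (1 / d) * inverse (real n)) \<le> \<phi> n x"
            using \<open>0 < real n * d\<close> \<open>real n * d \<le> real n * \<psi> n x\<close>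
            by (auto simp: \<phi>_def flat_def)
        qed
        moreover have "\<forall>\<^sub>F n in sequentially. \<phi> n x \<le> 1"
          by (simp add: \<phi>_def flat_one_bounds)
        ultimately have "(\<lambda>n. \<phi> n x) \<longlonglongrightarrow> 1"
          by (rule tendsto_sandwich[OF _ _ lim tendsto_const])
        then show ?thesis using True by simp
      next
        case False
        have "bump (p i) (r i) x = 0" for i
        proof -
          have "x \<notin> ball (p i) (r i)" using False pr(3)[of i] ball_subset_cball by blast
          then show ?thesis using pos_iff[of i x] nonneg[of i x] by simp
        qed
        then show ?thesis using False by (simp add: \<phi>_def \<psi>_def flat_def)
      qed
    qed
  qed
qed

section \<open>The fundamental lemma of the calculus of variations\<close>

lemma integrable_mult_bounded:
  fixes f g :: "'a \<Rightarrow> real"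
  assumes "integrable M f" and "g \<in> borel_measurable M" and "\<And>x. \<bar>g x\<bar> \<le> C"
  shows "integrable M (\<lambda>x. f x * g x)"
proof (rule Bochner_Integration.integrable_bound)
  show "integrable M (\<lambda>x. C * f x)" using assms(1) by simp
  show "(\<lambda>x. f x * g x) \<in> borel_measurable M" using assms by measurable
  show "AE x in M. norm (f x * g x) \<le> norm (C * f x)"
  proof (rule AE_I2)
    fix x
    have "\<bar>f x\<bar> * \<bar>g x\<bar> \<le> \<bar>f x\<bar> * \<bar>C\<bar>"
      using assms(3)[of x] by (intro mult_left_mono) auto
    then show "norm (f x * g x) \<le> norm (C * f x)" by (simp add: abs_mult mult.commute)
  qed
qed

text \<open>
  Indicators of open subsets are bounded pointwise limits of test functions, so by dominated
  convergence \<open>h\<close> has integral zero over every open subset of \<open>V\<close>. The sets $A$ for which the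
  integral over $A \cap V$ vanishes form a Dynkin system, hence they include all Borel sets, in
  particular those where \<open>h\<close> is positive or negative on \<open>V\<close>.
\<close>

lemma fundamental_lemma_calculus_of_variations:
  fixes h :: "'a::euclidean_space \<Rightarrow> real"
  assumes V: "open V" and h: "integrable lborel h"
    and orth: "\<And>\<phi>. \<phi> \<in> test_functions V \<Longrightarrow> (\<integral>x. h x * \<phi> x \<partial>lborel) = 0"
  shows "AE x in lborel. x \<in> V \<longrightarrow> h x = 0"
proof -
  have [measurable]: "h \<in> borel_measurable borel" using h by auto
  have [measurable]: "V \<in> sets borel" using V by simp
  have zero_open: "(\<integral>x. h x * indicator W x \<partial>lborel) = 0" if W: "open W" "W \<subseteq> V" for W
  proof -
    have [measurable]: "W \<in> sets borel" using W by simp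
    obtain \<phi> where \<phi>: "\<And>n. \<phi> n \<in> test_functions W" "\<And>n x. 0 \<le> \<phi> n x" "\<And>n x. \<phi> n x \<le> 1"
      "\<And>x. (\<lambda>n. \<phi> n x) \<longlonglongrightarrow> indicator W x"
      using indicator_open_limit_test_functions[OF W(1)] by blast
    have [measurable]: "\<phi> n \<in> borel_measurable borel" for n
      using \<phi>(1) by (rule test_function_measurable)
    have "(\<lambda>n. \<integral>x. h x * \<phi> n x \<partial>lborel) \<longlonglongrightarrow> (\<integral>x. h x * indicator W x \<partial>lborel)"
    proof (rule integral_dominated_convergence[where w = "\<lambda>x. \<bar>h x\<bar>"])
      show "integrable lborel (\<lambda>x. \<bar>h x\<bar>)" using h by simp
      show "AE x in lborel. (\<lambda>n. h x * \<phi> n x) \<longlonglongrightarrow> h x * indicator W x"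
        by (intro AE_I2 tendsto_mult tendsto_const \<phi>)
      show "AE x in lborel. norm (h x * \<phi> n x) \<le> \<bar>h x\<bar>" for n
        using \<phi>(2,3) by (intro AE_I2) (simp add: abs_mult mult_left_le)
    qed auto
    moreover have "(\<integral>x. h x * \<phi> n x \<partial>lborel) = 0" for n
      by (rule orth) (rule test_functions_mono[OF \<phi>(1) W(2)])
    ultimately show ?thesis
      by (simp add: LIMSEQ_const_iff)
  qed
  define k where "k x = h x * indicator V x" for x
  have k: "integrable lborel k"
    unfolding k_def using h by (intro integrable_mult_bounded[where C = 1]) auto
  then have [measurable]: "k \<in> borel_measurable borel" by auto
  have kA: "integrable lborel (\<lambda>x. k x * indicator A x)" if "A \<in> sets borel" for A
    using k that by (intro integrable_mult_bounded[where C = 1]) (auto simp: indicator_def)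
  have zero_sets: "(\<integral>x. k x * indicator A x \<partial>lborel) = 0" if "A \<in> sets borel" for A
  proof -
    have "Int_stable {S :: 'a set. open S}" "{S :: 'a set. open S} \<subseteq> Pow UNIV"
      by (auto simp: Int_stable_def)
    moreover have "A \<in> sigma_sets UNIV {S. open S}"
      using that by (simp add: sets_borel)
    ultimately show ?thesis
    proof (induction rule: sigma_sets_induct_disjoint)
      case (basic A)
      have "k x * indicator A x = h x * indicator (V \<inter> A) x" for x
        by (simp add: k_def indicator_def)
      then show ?case using zero_open[of "V \<inter> A"] basic V by (simp add: open_Int)
    next
      case (compl A)
      then have A: "A \<in> sets borel" by (simp add: sets_borel)
      have "k x * indicator (UNIV - A) x = k x - k x * indicator A x" for x
        by (simp add: indicator_def)
      moreover have "(\<integral>x. k x \<partial>lborel) = 0"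
        using zero_open[OF V] by (simp add: k_def)
      ultimately show ?case
        using compl k kA[OF A] by simp
    next
      case (union A)
      then have A: "A i \<in> sets borel" for i by (auto simp: sets_borel)
      have "(\<integral>x. k x * indicator (\<Union>i. A i) x \<partial>lborel) = (\<Sum>i. \<integral>x. k x * indicator (A i) x \<partial>lborel)"
        using lebesgue_integral_countable_add[of A lborel k] A union(1) kA[of "\<Union>i. A i"]
        by (auto simp: set_lebesgue_integral_def set_integrable_def mult.commute disjoint_family_on_def)
      then show ?case using union by simp
    qed auto
  qed
  have "AE x in lborel. k x * indicator {x. k x > 0} x = 0"
  proof (rule integral_nonneg_eq_0_iff_AE[THEN iffD1])
    show "(\<integral>x. k x * indicator {x. k x > 0} x \<partial>lborel) = 0" by (rule zero_sets) measurable
    show "integrable lborel (\<lambda>x. k x * indicator {x. k x > 0} x)" by (rule kA) measurable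
  qed (auto simp: indicator_def)
  moreover have "AE x in lborel. - (k x * indicator {x. k x < 0} x) = 0"
  proof (rule integral_nonneg_eq_0_iff_AE[THEN iffD1])
    show "(\<integral>x. - (k x * indicator {x. k x < 0} x) \<partial>lborel) = 0"
      by (subst Bochner_Integration.integral_minus, subst zero_sets) auto
    show "integrable lborel (\<lambda>x. - (k x * indicator {x. k x < 0} x))"
      by (intro Bochner_Integration.integrable_minus kA) measurable
  qed (auto simp: indicator_def)
  ultimately show ?thesis
    by eventually_elim (auto simp: k_def indicator_def split: if_splits)
qed

text \<open>
  Passing to a Borel function on the whole space, zero a.e. outside \<open>\<Omega>\<close>, keeps all integrals against
  Borel functions and allows translations and Fubini.
\<close>

lemma integrable_lebesgue_on_borel_representative:
  fixes u :: "'a::euclidean_space \<Rightarrow> real"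
  assumes "open \<Omega>" and u: "integrable (lebesgue_on \<Omega>) u"
  obtains h where "integrable lborel h" and "AE x in lebesgue_on \<Omega>. u x = h x"
    and "\<forall>\<phi>\<in>borel_measurable borel.
      (\<integral>x. u x * \<phi> x \<partial>lebesgue_on \<Omega>) = (\<integral>x. h x * \<phi> x \<partial>lborel)"
proof -
  have \<Omega>: "\<Omega> \<inter> space lebesgue \<in> sets lebesgue" using assms(1) by simp
  define k where "k x = indicator \<Omega> x *\<^sub>R u x" for x
  have k: "integrable lebesgue k"
    using u unfolding k_def by (simp only: integrable_restrict_space[OF \<Omega>])
  then obtain h where h: "h \<in> borel_measurable lborel" "AE x in lborel. k x = h x"
    using completion_ex_borel_measurable_real[of k lborel] by auto
  have kh: "AE x in lebesgue. k x = h x" using h(2) by (rule AE_completion)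
  have hm: "h \<in> borel_measurable lebesgue" using h(1) by (rule measurable_completion)
  have "integrable lebesgue h"
    using k hm kh by (rule integrable_cong_AE_imp)
  then have int: "integrable lborel h" using h(1) by (simp add: integrable_completion)
  have "AE x in lebesgue_on \<Omega>. u x = h x"
    unfolding AE_restrict_space_iff[OF \<Omega>] using kh by eventually_elim (auto simp: k_def)
  moreover have "(\<integral>x. u x * \<phi> x \<partial>lebesgue_on \<Omega>) = (\<integral>x. h x * \<phi> x \<partial>lborel)"
    if \<phi>: "\<phi> \<in> borel_measurable borel" for \<phi>
  proof -
    have \<phi>': "\<phi> \<in> borel_measurable lebesgue" using \<phi> by (auto intro: measurable_completion)
    have "(\<integral>x. u x * \<phi> x \<partial>lebesgue_on \<Omega>) = (\<integral>x. k x * \<phi> x \<partial>lebesgue)"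
      by (simp add: integral_restrict_space[OF \<Omega>] k_def mult.assoc)
    also have "\<dots> = (\<integral>x. h x * \<phi> x \<partial>lebesgue)"
    proof (rule integral_cong_AE)
      show "(\<lambda>x. k x * \<phi> x) \<in> borel_measurable lebesgue" using k \<phi>' by auto
      show "(\<lambda>x. h x * \<phi> x) \<in> borel_measurable lebesgue" using hm \<phi>' by auto
      show "AE x in lebesgue. k x * \<phi> x = h x * \<phi> x" using kh by eventually_elim simp
    qed
    also have "\<dots> = (\<integral>x. h x * \<phi> x \<partial>lborel)"
      using h(1) \<phi> by (intro integral_completion) auto
    finally show ?thesis .
  qed
  ultimately show ?thesis using int that by blast
qed

section \<open>Functions with vanishing weak gradient\<close>

lemma AE_lborel_open_witness:
  fixes U :: "'a::euclidean_space set"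
  assumes "AE x in lborel. P x" and U: "open U" "U \<noteq> {}"
  shows "\<exists>x\<in>U. P x"
proof (rule ccontr)
  assume "\<not> ?thesis"
  with assms(1) have "AE x in lborel. x \<notin> U" by (auto elim: AE_mp)
  then have "U \<in> null_sets lborel" using U by (simp add: AE_iff_null_sets)
  then have "negligible U" by (simp add: negligible_iff_null_sets null_sets_completionI)
  then show False using U open_not_negligible by blast
qed

lemma lborel_integral_shift:
  fixes f :: "'a::euclidean_space \<Rightarrow> real"
  assumes "f \<in> borel_measurable borel"
  shows "(\<integral>x. f (x + c) \<partial>lborel) = (\<integral>x. f x \<partial>lborel)"
proof -
  have "(\<integral>x. f x \<partial>lborel) = (\<integral>x. f x \<partial>distr lborel borel ((+) c))"
    by (simp add: lborel_distr_plus)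
  also have "\<dots> = (\<integral>x. f (c + x) \<partial>lborel)"
    using assms by (intro integral_distr) auto
  finally show ?thesis by (simp add: add.commute)
qed

lemma lborel_integrable_shift:
  fixes f :: "'a::euclidean_space \<Rightarrow> real"
  assumes "integrable lborel f"
  shows "integrable lborel (\<lambda>x. f (x + c))"
proof -
  have "integrable (distr lborel borel ((+) c)) f"
    using assms by (simp add: lborel_distr_plus)
  then have "integrable lborel (\<lambda>x. f (c + x))"
    by (rule integrable_distr[rotated]) simp
  then show ?thesis by (simp add: add.commute)
qed

text \<open>
  Moving the test function along the segment from $0$ to \<open>h\<close> changes the integral at the rate
  $\int w\, \partial_h \phi(x + t h)\,dx$, which is zero because every translate on the way is a test
  function on \<open>\<Omega>\<close>.
\<close>

lemma zero_weak_gradient_shift: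
  fixes w :: "'a::euclidean_space \<Rightarrow> real"
  assumes w: "integrable lborel w"
    and zero: "\<And>\<phi> b. \<phi> \<in> test_functions \<Omega> \<Longrightarrow> b \<in> Basis \<Longrightarrow>
      (\<integral>x. w x * frechet_derivative \<phi> (at x) b \<partial>lborel) = 0"
    and \<phi>: "\<phi> \<in> test_functions V"
    and path: "\<And>x t. x \<in> V \<Longrightarrow> 0 \<le> t \<Longrightarrow> t \<le> 1 \<Longrightarrow> x - t *\<^sub>R h \<in> \<Omega>"
  shows "(\<integral>x. w x * \<phi> (x + h) \<partial>lborel) = (\<integral>x. w x * \<phi> x \<partial>lborel)"
proof -
  have [measurable]: "w \<in> borel_measurable borel" "\<phi> \<in> borel_measurable borel"
    using w test_function_measurable[OF \<phi>] by auto
  define d where "d b y = frechet_derivative \<phi> (at y) b" for b y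
  have d_test: "d b \<in> test_functions V" if "b \<in> Basis" for b
    unfolding d_def using \<phi> that by (rule test_function_derivative)
  define D where "D y = (\<Sum>b\<in>Basis. (h \<bullet> b) * d b y)" for y
  have D_eq: "frechet_derivative \<phi> (at y) (s *\<^sub>R h) = D y * s" for y s
  proof -
    have "linear (frechet_derivative \<phi> (at y))"
      using test_function_has_derivative[OF \<phi>] by (rule has_derivative_linear)
    then have "frechet_derivative \<phi> (at y) (s *\<^sub>R (\<Sum>b\<in>Basis. (h \<bullet> b) *\<^sub>R b)) = s * D y"
      by (simp only: linear_cmul linear_sum d_def D_def real_scaleR_def)
    then show ?thesis by (simp add: euclidean_representation)
  qed
  have "\<exists>C. \<forall>y. \<bar>d b y\<bar> \<le> C" if "b \<in> Basis" for b
    using test_function_bounded[OF d_test[OF that]] by metis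
  then obtain C where C: "\<And>b y. b \<in> Basis \<Longrightarrow> \<bar>d b y\<bar> \<le> C b"
    by metis
  define K where "K = (\<Sum>b\<in>Basis. \<bar>h \<bullet> b\<bar> * C b)"
  have K: "\<bar>D y\<bar> \<le> K" for y
    unfolding D_def K_def by (rule sum_abs[THEN order_trans])
      (auto intro!: sum_mono mult_left_mono C simp: abs_mult)
  obtain B where B: "\<And>x. \<bar>\<phi> x\<bar> \<le> B" using test_function_bounded[OF \<phi>] by metis
  have along: "((\<lambda>s. \<phi> (x + s *\<^sub>R h)) has_real_derivative D (x + s *\<^sub>R h)) (at s)" for x s
  proof -
    have "((\<lambda>s. x + s *\<^sub>R h) has_derivative (\<lambda>s. s *\<^sub>R h)) (at s)"
      by (auto intro!: derivative_eq_intros)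
    from has_derivative_compose[OF this test_function_has_derivative[OF \<phi>]]
    show ?thesis unfolding has_field_derivative_def D_eq .
  qed
  define F where "F t = (\<integral>x. w x * \<phi> (x + t *\<^sub>R h) \<partial>lborel)" for t
  have int: "integrable lborel (\<lambda>x. w x * \<phi> (x + t *\<^sub>R h))" for t
    using w B by (intro integrable_mult_bounded) auto
  have "(F has_derivative (\<lambda>s. 0)) (at t within {0..1})" if t: "t \<in> {0..1}" for t
  proof -
    \<comment> \<open>The weak gradient condition, applied to the translated test function.\<close>
    have shifted: "(\<integral>x. w x * d b (x + t *\<^sub>R h) \<partial>lborel) = 0" if b: "b \<in> Basis" for b
    proof -
      let ?\<psi> = "\<lambda>x. \<phi> (x + t *\<^sub>R h)"
      have "?\<psi> \<in> test_functions \<Omega>"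
        using \<phi> by (rule test_function_shift) (use t path in auto)
      moreover have "frechet_derivative ?\<psi> (at x) = frechet_derivative \<phi> (at (x + t *\<^sub>R h))" for x
      proof -
        have "((\<lambda>x. x + t *\<^sub>R h) has_derivative (\<lambda>v. v)) (at x)"
          by (auto intro!: derivative_eq_intros)
        from has_derivative_compose[OF this test_function_has_derivative[OF \<phi>]]
        show ?thesis by (rule frechet_derivative_at[symmetric])
      qed
      ultimately show ?thesis using zero[of ?\<psi> b] b by (simp add: d_def)
    qed
    have D0: "(\<integral>x. w x * D (x + t *\<^sub>R h) \<partial>lborel) = 0"
    proof -
      have dm: "d b \<in> borel_measurable borel" if "b \<in> Basis" for b
        using d_test[OF that] by (rule test_function_measurable)
      have "integrable lborel (\<lambda>x. w x * d b (x + t *\<^sub>R h))" if "b \<in> Basis" for b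
        using w C[OF that] dm[OF that] by (intro integrable_mult_bounded[of _ _ _ "C b"]) auto
      then have "(\<integral>x. (\<Sum>b\<in>Basis. (h \<bullet> b) * (w x * d b (x + t *\<^sub>R h))) \<partial>lborel) =
          (\<Sum>b\<in>Basis. (h \<bullet> b) * (\<integral>x. w x * d b (x + t *\<^sub>R h) \<partial>lborel))"
        by (subst Bochner_Integration.integral_sum) auto
      then show ?thesis
        by (simp add: D_def sum_distrib_left algebra_simps shifted)
    qed
    have "((\<lambda>s. (F s - F t) / (s - t)) \<longlongrightarrow> 0) (at t within {0..1})"
      unfolding tendsto_at_iff_sequentially comp_def
    proof (intro allI impI)
      fix X :: "nat \<Rightarrow> real"
      assume X: "\<forall>i. X i \<in> {0..1} - {t}" "X \<longlonglongrightarrow> t"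
      \<comment> \<open>Difference quotients, dominated by \<open>K\<close> through the mean value inequality.\<close>
      define q where "q n x = (\<phi> (x + X n *\<^sub>R h) - \<phi> (x + t *\<^sub>R h)) / (X n - t)" for n x
      have "(\<lambda>n. \<integral>x. w x * q n x \<partial>lborel) \<longlonglongrightarrow> (\<integral>x. w x * D (x + t *\<^sub>R h) \<partial>lborel)"
      proof (rule integral_dominated_convergence[where w = "\<lambda>x. K * \<bar>w x\<bar>"])
        have lim: "(\<lambda>n. q n x) \<longlonglongrightarrow> D (x + t *\<^sub>R h)" for x
          using along[of x t] X unfolding has_field_derivative_iff tendsto_at_iff_sequentially comp_def q_def
          by auto
        then show "AE x in lborel. (\<lambda>n. w x * q n x) \<longlonglongrightarrow> w x * D (x + t *\<^sub>R h)"
          by (intro AE_I2 tendsto_mult tendsto_const)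
        show qm: "(\<lambda>x. w x * q n x) \<in> borel_measurable lborel" for n
          unfolding q_def by measurable
        have "D \<in> borel_measurable borel"
          unfolding D_def by (intro borel_measurable_sum borel_measurable_times borel_measurable_const)
            (use d_test test_function_measurable in blast)
        then show "(\<lambda>x. w x * D (x + t *\<^sub>R h)) \<in> borel_measurable lborel"
          by measurable
        show "integrable lborel (\<lambda>x. K * \<bar>w x\<bar>)" using w by simp
        have "\<bar>q n x\<bar> \<le> K" for n x
        proof -
          have "norm (\<phi> (x + X n *\<^sub>R h) - \<phi> (x + t *\<^sub>R h)) \<le> K * norm (X n - t)"
            by (rule field_differentiable_bound[where S = UNIV and f = "\<lambda>s. \<phi> (x + s *\<^sub>R h)", OF _ along])
              (use K in auto)
          then show ?thesis using X(1) by (simp add: q_def divide_le_eq)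
        qed
        then show "AE x in lborel. norm (w x * q n x) \<le> K * \<bar>w x\<bar>" for n
          by (intro AE_I2) (simp add: abs_mult mult.commute[of "\<bar>w _\<bar>"] mult_right_mono)
      qed
      moreover have "(\<integral>x. w x * q n x \<partial>lborel) = (F (X n) - F t) / (X n - t)" for n
      proof -
        have "w x * q n x = (w x * \<phi> (x + X n *\<^sub>R h) - w x * \<phi> (x + t *\<^sub>R h)) / (X n - t)" for x
          by (simp add: q_def right_diff_distrib)
        then show ?thesis
          using int by (simp add: F_def)
      qed
      ultimately show "(\<lambda>n. (F (X n) - F t) / (X n - t)) \<longlonglongrightarrow> 0"
        using D0 by simp
    qed
    then have "(F has_real_derivative 0) (at t within {0..1})"
      by (simp add: has_field_derivative_iff)
    then show ?thesis
      unfolding has_field_derivative_def by (rule back_subst[where P = "\<lambda>f. (F has_derivative f) _"]) auto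
  qed
  from has_derivative_zero_constant[OF _ this] obtain c where "\<And>t. t \<in> {0..1} \<Longrightarrow> F t = c"
    by auto
  then have "F 1 = F 0" by simp
  then show ?thesis by (simp add: F_def)
qed

text \<open>
  By the previous lemma and the fundamental lemma, \<open>w\<close> agrees a.e. with each of its small
  translates. Fubini exchanges the order of quantification: for almost every \<open>x\<close>, the values
  \<open>w (x + h)\<close> equal \<open>w x\<close> for almost every small \<open>h\<close>, so one good point \<open>x\<close> near \<open>p\<close> supplies the
  constant.
\<close>

lemma zero_weak_gradient_locally_constant:
  fixes w :: "'a::euclidean_space \<Rightarrow> real"
  assumes "open \<Omega>" and w: "integrable lborel w"
    and zero: "\<And>\<phi> b. \<phi> \<in> test_functions \<Omega> \<Longrightarrow> b \<in> Basis \<Longrightarrow>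
      (\<integral>x. w x * frechet_derivative \<phi> (at x) b \<partial>lborel) = 0"
    and p: "p \<in> \<Omega>"
  shows "\<exists>c r. 0 < r \<and> (AE x in lborel. x \<in> ball p r \<longrightarrow> w x = c)"
proof -
  have [measurable]: "w \<in> borel_measurable borel" using w by auto
  obtain e where "e > 0" "ball p e \<subseteq> \<Omega>"
    using assms(1) p open_contains_ball by blast
  \<comment> \<open>Half the radius leaves room to translate a ball by up to its own radius inside \<open>\<Omega>\<close>.\<close>
  define d where "d = e / 2"
  have d: "d > 0" "ball p (d + d) \<subseteq> \<Omega>"
    using \<open>e > 0\<close> \<open>ball p e \<subseteq> \<Omega>\<close> by (auto simp: d_def)
  have shift: "AE x in lborel. h \<in> ball 0 d \<longrightarrow> x \<in> ball p d \<longrightarrow> w (x + h) = w x" for h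
  proof (cases "h \<in> ball 0 d")
    case True
    have int: "integrable lborel (\<lambda>x. w (x + h))"
      using w by (rule lborel_integrable_shift)
    have "AE x in lborel. x \<in> ball p d \<longrightarrow> w (x + h) - w x = 0"
    proof (rule fundamental_lemma_calculus_of_variations)
      show "integrable lborel (\<lambda>x. w (x + h) - w x)" using int w by simp
      fix \<phi> assume \<phi>: "\<phi> \<in> test_functions (ball p d)"
      obtain B where B: "\<And>x. \<bar>\<phi> x\<bar> \<le> B" using test_function_bounded[OF \<phi>] by metis
      have [measurable]: "\<phi> \<in> borel_measurable borel" using \<phi> by (rule test_function_measurable)
      have "(\<integral>x. (w (x + h) - w x) * \<phi> x \<partial>lborel) =
          (\<integral>x. w (x + h) * \<phi> x \<partial>lborel) - (\<integral>x. w x * \<phi> x \<partial>lborel)"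
        unfolding left_diff_distrib using int w B
        by (intro Bochner_Integration.integral_diff integrable_mult_bounded) auto
      also have "(\<integral>x. w (x + h) * \<phi> x \<partial>lborel) = (\<integral>x. w x * \<phi> (x + - h) \<partial>lborel)"
        using lborel_integral_shift[of "\<lambda>x. w x * \<phi> (x + - h)" h] by simp
      also have "\<dots> = (\<integral>x. w x * \<phi> x \<partial>lborel)"
      proof (rule zero_weak_gradient_shift[OF w zero \<phi>])
        fix t :: real and y :: 'a
        assume y: "y \<in> ball p d" and t: "0 \<le> t" "t \<le> 1"
        have "norm (t *\<^sub>R h) \<le> norm h" using t by (simp add: mult_left_le_one_le)
        then have "dist p (y + t *\<^sub>R h) < d + d"
          using y True norm_triangle_ineq4[of "p - y" "t *\<^sub>R h"]
          by (simp add: dist_norm algebra_simps)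
        then show "y - t *\<^sub>R - h \<in> \<Omega>" using d(2) by auto
      qed
      finally show "(\<integral>x. (w (x + h) - w x) * \<phi> x \<partial>lborel) = 0" by simp
    qed simp
    then show ?thesis by eventually_elim auto
  qed simp
  have "(AE h in lborel. AE x in lborel. h \<in> ball 0 d \<longrightarrow> x \<in> ball p d \<longrightarrow> w (x + h) = w x) \<longleftrightarrow>
      (AE x in lborel. AE h in lborel. h \<in> ball 0 d \<longrightarrow> x \<in> ball p d \<longrightarrow> w (x + h) = w x)"
    unfolding mem_ball by (rule lborel_pair.AE_commute) measurable
  then have "AE x in lborel. AE h in lborel. h \<in> ball 0 d \<longrightarrow> x \<in> ball p d \<longrightarrow> w (x + h) = w x"
    using shift by simp
  \<comment> \<open>Choosing \<open>x\<close> within \<open>d / 2\<close> of \<open>p\<close> makes the ball of radius \<open>d\<close> around \<open>x\<close> cover a ball around \<open>p\<close>.\<close>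
  from AE_lborel_open_witness[OF this, of "ball p (d / 2)"] d(1)
  obtain x where x: "x \<in> ball p (d / 2)"
    "AE h in lborel. h \<in> ball 0 d \<longrightarrow> x \<in> ball p d \<longrightarrow> w (x + h) = w x" by auto
  have "AE h in lborel. x + h \<in> ball x d \<longrightarrow> w (x + h) = w x"
    using x(2) by eventually_elim (use x(1) d(1) in \<open>auto simp: dist_norm\<close>)
  then have "AE y in distr lborel borel ((+) x). y \<in> ball x d \<longrightarrow> w y = w x"
    by (subst AE_distr_iff) auto
  then have "AE y in lborel. y \<in> ball x d \<longrightarrow> w y = w x"
    unfolding lborel_distr_plus .
  note near_x = this
  have sub: "ball p (d / 2) \<subseteq> ball x d"
  proof
    fix y assume "y \<in> ball p (d / 2)"
    then show "y \<in> ball x d"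
      using x(1) dist_triangle[of x y p] by (simp add: dist_commute)
  qed
  have "AE y in lborel. y \<in> ball p (d / 2) \<longrightarrow> w y = w x"
    using near_x by (rule eventually_mono) (use sub in blast)
  then show ?thesis using d(1) by (intro exI[of _ "w x"] exI[of _ "d / 2"]) auto
qed

text \<open>
  The local constants agree on overlapping balls, because a nonempty open set is not a null set;
  connectedness makes them globally equal, and being null is a local property.
\<close>

lemma zero_weak_gradient_constant:
  fixes w :: "'a::euclidean_space \<Rightarrow> real"
  assumes "open \<Omega>" and "connected \<Omega>" and w: "integrable lborel w"
    and zero: "\<And>\<phi> b. \<phi> \<in> test_functions \<Omega> \<Longrightarrow> b \<in> Basis \<Longrightarrow>
      (\<integral>x. w x * frechet_derivative \<phi> (at x) b \<partial>lborel) = 0"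
  obtains c where "AE x in lebesgue. x \<in> \<Omega> \<longrightarrow> w x = c"
proof -
  have "\<exists>c r. 0 < r \<and> (AE x in lborel. x \<in> ball p r \<longrightarrow> w x = c)" if "p \<in> \<Omega>" for p
    using assms(1) w zero that by (rule zero_weak_gradient_locally_constant)
  then obtain c r where r: "\<And>p. p \<in> \<Omega> \<Longrightarrow> 0 < r p"
    and c: "\<And>p. p \<in> \<Omega> \<Longrightarrow> AE x in lborel. x \<in> ball p (r p) \<longrightarrow> w x = c p"
    by metis
  have "c constant_on \<Omega>"
  proof (rule locally_constant_imp_constant)
    fix p assume p: "p \<in> \<Omega>"
    have cp: "c q = c p" if q: "q \<in> \<Omega> \<inter> ball p (r p)" for q
    proof -
      have "AE x in lborel. (x \<in> ball p (r p) \<longrightarrow> w x = c p) \<and> (x \<in> ball q (r q) \<longrightarrow> w x = c q)"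
        using c[OF p] c[of q] q by (intro AE_conjI) auto
      moreover have "q \<in> ball p (r p) \<inter> ball q (r q)" using q r[of q] by auto
      ultimately show ?thesis
        using AE_lborel_open_witness[of _ "ball p (r p) \<inter> ball q (r q)"] by fastforce
    qed
    have "openin (top_of_set \<Omega>) (\<Omega> \<inter> ball p (r p))" by (intro openin_open_Int) simp
    moreover have "p \<in> \<Omega> \<inter> ball p (r p)" using p r[OF p] by simp
    ultimately show "\<exists>T. openin (top_of_set \<Omega>) T \<and> p \<in> T \<and> (\<forall>x\<in>T. c x = c p)"
      using cp by blast
  qed (rule assms(2))
  then obtain c0 where c0: "\<And>p. p \<in> \<Omega> \<Longrightarrow> c p = c0" by (auto simp: constant_on_def)
  have "negligible {x \<in> \<Omega>. w x \<noteq> c0}"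
  proof (rule locally_negligible_alt[THEN iffD2], rule ballI)
    fix p assume "p \<in> {x \<in> \<Omega>. w x \<noteq> c0}"
    then have p: "p \<in> \<Omega>" "w p \<noteq> c0" by auto
    have "AE x in lebesgue. x \<in> ball p (r p) \<longrightarrow> w x = c0"
      using AE_completion[OF c[OF p(1)]] c0[OF p(1)] by simp
    then have "{x. \<not> (x \<in> ball p (r p) \<longrightarrow> w x = c0)} \<in> null_sets lebesgue"
      by (simp add: completion.AE_iff_null_sets)
    then have "negligible {x. \<not> (x \<in> ball p (r p) \<longrightarrow> w x = c0)}"
      by (simp add: negligible_iff_null_sets)
    then have "negligible ({x \<in> \<Omega>. w x \<noteq> c0} \<inter> ball p (r p))"
      by (rule negligible_subset) auto
    then show "\<exists>U. openin (top_of_set {x \<in> \<Omega>. w x \<noteq> c0}) U \<and> p \<in> U \<and> negligible U"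
      using p r[OF p(1)] openin_open_Int[of "ball p (r p)" "{x \<in> \<Omega>. w x \<noteq> c0}"]
      by (intro exI[of _ "{x \<in> \<Omega>. w x \<noteq> c0} \<inter> ball p (r p)"]) simp
  qed
  then have "{x. \<not> (x \<in> \<Omega> \<longrightarrow> w x = c0)} \<in> null_sets lebesgue"
    by (simp add: negligible_iff_null_sets)
  then have "AE x in lebesgue. x \<in> \<Omega> \<longrightarrow> w x = c0"
    by (simp add: completion.AE_iff_null_sets)
  then show ?thesis by (rule that)
qed

section \<open>The Sobolev space as a vector space\<close>

lemma L2_lincomb:
  assumes "u \<in> L2 M" and "v \<in> L2 M"
  shows "(\<lambda>x. a * u x + b * v x) \<in> L2 M"
proof -
  have [measurable]: "u \<in> borel_measurable M" "v \<in> borel_measurable M"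
    using assms by (auto simp: L2_def)
  have "integrable M (\<lambda>x. (a * u x + b * v x)\<^sup>2)"
  proof (rule Bochner_Integration.integrable_bound)
    show "integrable M (\<lambda>x. 2 * a\<^sup>2 * (u x)\<^sup>2 + 2 * b\<^sup>2 * (v x)\<^sup>2)"
      using assms by (auto simp: L2_def)
    have "(a * u x + b * v x)\<^sup>2 \<le> 2 * a\<^sup>2 * (u x)\<^sup>2 + 2 * b\<^sup>2 * (v x)\<^sup>2" for x
      using zero_le_power2[of "a * u x - b * v x"] by (simp add: power2_eq_square algebra_simps)
    then show "AE x in M. norm ((a * u x + b * v x)\<^sup>2) \<le> norm (2 * a\<^sup>2 * (u x)\<^sup>2 + 2 * b\<^sup>2 * (v x)\<^sup>2)"
      by (intro AE_I2) (simp add: order_trans[OF _ abs_ge_self])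
  qed measurable
  then show ?thesis by (auto simp: L2_def)
qed

lemma L2_mult_integrable:
  assumes "u \<in> L2 M" and "v \<in> L2 M"
  shows "integrable M (\<lambda>x. u x * v x)"
proof (rule Bochner_Integration.integrable_bound)
  show "integrable M (\<lambda>x. (u x)\<^sup>2 + (v x)\<^sup>2)"
    using assms by (auto simp: L2_def)
  show "(\<lambda>x. u x * v x) \<in> borel_measurable M"
    using assms by (auto simp: L2_def)
  have "\<bar>p * q\<bar> \<le> p\<^sup>2 + q\<^sup>2" for p q :: real
  proof -
    have "2 * (\<bar>p\<bar> * \<bar>q\<bar>) \<le> p\<^sup>2 + q\<^sup>2"
      using zero_le_power2[of "\<bar>p\<bar> - \<bar>q\<bar>"] by (simp add: power2_diff)
    then show ?thesis
      using abs_ge_zero[of "p * q"] by (simp only: abs_mult)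
  qed
  then show "AE x in M. norm (u x * v x) \<le> norm ((u x)\<^sup>2 + (v x)\<^sup>2)"
    by (intro AE_I2) (simp add: order_trans[OF _ abs_ge_self])
qed

lemma (in finite_measure) L2_integrable:
  assumes "u \<in> L2 M" shows "integrable M u"
  using L2_mult_integrable[OF assms, of "\<lambda>x. 1"] by (simp add: L2_def)

context
  fixes \<Omega> :: "'a::euclidean_space set"
  assumes open_domain: "open \<Omega>" and bounded_domain: "bounded \<Omega>"
begin

lemma AE_lebesgue_onI: "AE x in lborel. x \<in> \<Omega> \<longrightarrow> P x \<Longrightarrow> AE x in lebesgue_on \<Omega>. P x"
  using open_domain by (simp add: AE_restrict_space_iff AE_completion)

lemma finite_measure_domain: "finite_measure (lebesgue_on \<Omega>)"
  using open_domain bounded_domain by (intro finite_measure_lebesgue_on lmeasurable_open)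

lemma L2_domain_integrable: "u \<in> L2 (lebesgue_on \<Omega>) \<Longrightarrow> integrable (lebesgue_on \<Omega>) u"
  by (rule finite_measure.L2_integrable[OF finite_measure_domain])

lemma test_function_measurable_on: "\<phi> \<in> test_functions V \<Longrightarrow> \<phi> \<in> borel_measurable (lebesgue_on \<Omega>)"
  using test_function_measurable[of \<phi> V]
  by (intro measurable_restrict_space1 measurable_completion) auto

lemma L2_test_integrable:
  assumes "u \<in> L2 (lebesgue_on \<Omega>)" and "\<phi> \<in> test_functions V"
  shows "integrable (lebesgue_on \<Omega>) (\<lambda>x. u x * \<phi> x)"
proof -
  obtain C where "\<And>x. \<bar>\<phi> x\<bar> \<le> C" using test_function_bounded[OF assms(2)] by metis
  then show ?thesis
    using assms L2_domain_integrable test_function_measurable_on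
    by (intro integrable_mult_bounded) auto
qed

text \<open>
  Each component of the difference has integral zero against every test function, so the fundamental
  lemma applies. Uniqueness is what makes the arbitrarily chosen representative of the gradient depend
  linearly on the function, up to null sets.
\<close>

lemma weak_gradient_unique:
  assumes G: "is_weak_gradient \<Omega> u G" and H: "is_weak_gradient \<Omega> u H"
  shows "AE x in lebesgue_on \<Omega>. G x = H x"
proof -
  have "AE x in lebesgue_on \<Omega>. G x \<bullet> b = H x \<bullet> b" if b: "b \<in> Basis" for b
  proof -
    have L2: "(\<lambda>x. G x \<bullet> b) \<in> L2 (lebesgue_on \<Omega>)" "(\<lambda>x. H x \<bullet> b) \<in> L2 (lebesgue_on \<Omega>)"
      using G H b by (auto simp: is_weak_gradient_def)
    then have "integrable (lebesgue_on \<Omega>) (\<lambda>x. G x \<bullet> b - H x \<bullet> b)"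
      using L2_domain_integrable by auto
    then obtain h where h: "integrable lborel h" "AE x in lebesgue_on \<Omega>. G x \<bullet> b - H x \<bullet> b = h x"
      "\<forall>\<phi>\<in>borel_measurable borel.
        (\<integral>x. (G x \<bullet> b - H x \<bullet> b) * \<phi> x \<partial>lebesgue_on \<Omega>) = (\<integral>x. h x * \<phi> x \<partial>lborel)"
      by (rule integrable_lebesgue_on_borel_representative[OF open_domain])
    have "AE x in lborel. x \<in> \<Omega> \<longrightarrow> h x = 0"
    proof (rule fundamental_lemma_calculus_of_variations[OF open_domain h(1)])
      fix \<phi> assume \<phi>: "\<phi> \<in> test_functions \<Omega>"
      have "(\<integral>x. h x * \<phi> x \<partial>lborel) = (\<integral>x. (G x \<bullet> b) * \<phi> x - (H x \<bullet> b) * \<phi> x \<partial>lebesgue_on \<Omega>)"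
        using h(3)[rule_format, OF test_function_measurable[OF \<phi>]] by (simp add: left_diff_distrib)
      also have "\<dots> = (\<integral>x. (G x \<bullet> b) * \<phi> x \<partial>lebesgue_on \<Omega>) - (\<integral>x. (H x \<bullet> b) * \<phi> x \<partial>lebesgue_on \<Omega>)"
        using L2_test_integrable[OF L2(1) \<phi>] L2_test_integrable[OF L2(2) \<phi>] by simp
      also have "(\<integral>x. (G x \<bullet> b) * \<phi> x \<partial>lebesgue_on \<Omega>) = (\<integral>x. (H x \<bullet> b) * \<phi> x \<partial>lebesgue_on \<Omega>)"
      proof -
        have "(\<integral>x. u x * frechet_derivative \<phi> (at x) b \<partial>lebesgue_on \<Omega>) =
            - (\<integral>x. (G x \<bullet> b) * \<phi> x \<partial>lebesgue_on \<Omega>)"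
          using G b \<phi> unfolding is_weak_gradient_def by blast
        moreover have "(\<integral>x. u x * frechet_derivative \<phi> (at x) b \<partial>lebesgue_on \<Omega>) =
            - (\<integral>x. (H x \<bullet> b) * \<phi> x \<partial>lebesgue_on \<Omega>)"
          using H b \<phi> unfolding is_weak_gradient_def by blast
        ultimately show ?thesis by simp
      qed
      finally show "(\<integral>x. h x * \<phi> x \<partial>lborel) = 0" by simp
    qed
    then have "AE x in lebesgue_on \<Omega>. h x = 0" by (rule AE_lebesgue_onI)
    with h(2) show ?thesis by eventually_elim simp
  qed
  then have "AE x in lebesgue_on \<Omega>. \<forall>b\<in>Basis. G x \<bullet> b = H x \<bullet> b"
    by (intro AE_finite_allI) simp_all
  then show ?thesis by eventually_elim (auto intro: euclidean_eqI)
qed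

lemma is_weak_gradient_weak_gradient: "u \<in> H1 \<Omega> \<Longrightarrow> is_weak_gradient \<Omega> u (weak_gradient \<Omega> u)"
  unfolding weak_gradient_def by (rule someI_ex[of "is_weak_gradient \<Omega> u"]) (simp add: H1_def)

lemma weak_gradient_eqI:
  assumes "u \<in> H1 \<Omega>" and "is_weak_gradient \<Omega> u G"
  shows "AE x in lebesgue_on \<Omega>. weak_gradient \<Omega> u x = G x"
  using is_weak_gradient_weak_gradient[OF assms(1)] assms(2) by (rule weak_gradient_unique)

lemma is_weak_gradient_lincomb:
  assumes u: "u \<in> L2 (lebesgue_on \<Omega>)" and v: "v \<in> L2 (lebesgue_on \<Omega>)"
    and G: "is_weak_gradient \<Omega> u G" and H: "is_weak_gradient \<Omega> v H"
  shows "is_weak_gradient \<Omega> (\<lambda>x. a * u x + b * v x) (\<lambda>x. a *\<^sub>R G x + b *\<^sub>R H x)"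
  unfolding is_weak_gradient_def
proof (intro conjI ballI)
  fix e :: 'a assume e: "e \<in> Basis"
  have L2: "(\<lambda>x. G x \<bullet> e) \<in> L2 (lebesgue_on \<Omega>)" "(\<lambda>x. H x \<bullet> e) \<in> L2 (lebesgue_on \<Omega>)"
    using G H e by (auto simp: is_weak_gradient_def)
  then show "(\<lambda>x. (a *\<^sub>R G x + b *\<^sub>R H x) \<bullet> e) \<in> L2 (lebesgue_on \<Omega>)"
    using L2_lincomb[OF L2] by (simp add: inner_add_left)
  fix \<phi> assume \<phi>: "\<phi> \<in> test_functions \<Omega>"
  let ?d = "\<lambda>x. frechet_derivative \<phi> (at x) e"
  have d: "?d \<in> test_functions \<Omega>" using \<phi> e by (rule test_function_derivative)
  have "(\<integral>x. (a * u x + b * v x) * ?d x \<partial>lebesgue_on \<Omega>) =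
      (\<integral>x. a * (u x * ?d x) + b * (v x * ?d x) \<partial>lebesgue_on \<Omega>)"
    by (simp add: algebra_simps)
  also have "\<dots> = a * (\<integral>x. u x * ?d x \<partial>lebesgue_on \<Omega>) + b * (\<integral>x. v x * ?d x \<partial>lebesgue_on \<Omega>)"
    using L2_test_integrable[OF u d] L2_test_integrable[OF v d] by simp
  also have "(\<integral>x. u x * ?d x \<partial>lebesgue_on \<Omega>) = - (\<integral>x. (G x \<bullet> e) * \<phi> x \<partial>lebesgue_on \<Omega>)"
    using G \<phi> e unfolding is_weak_gradient_def by blast
  also have "(\<integral>x. v x * ?d x \<partial>lebesgue_on \<Omega>) = - (\<integral>x. (H x \<bullet> e) * \<phi> x \<partial>lebesgue_on \<Omega>)"
    using H \<phi> e unfolding is_weak_gradient_def by blast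
  also have "a * - (\<integral>x. (G x \<bullet> e) * \<phi> x \<partial>lebesgue_on \<Omega>) + b * - (\<integral>x. (H x \<bullet> e) * \<phi> x \<partial>lebesgue_on \<Omega>) =
      - (\<integral>x. a * ((G x \<bullet> e) * \<phi> x) + b * ((H x \<bullet> e) * \<phi> x) \<partial>lebesgue_on \<Omega>)"
    using L2_test_integrable[OF L2(1) \<phi>] L2_test_integrable[OF L2(2) \<phi>] by simp
  also have "(\<integral>x. a * ((G x \<bullet> e) * \<phi> x) + b * ((H x \<bullet> e) * \<phi> x) \<partial>lebesgue_on \<Omega>) =
      (\<integral>x. ((a *\<^sub>R G x + b *\<^sub>R H x) \<bullet> e) * \<phi> x \<partial>lebesgue_on \<Omega>)"
    by (simp add: inner_add_left algebra_simps)
  finally show "(\<integral>x. (a * u x + b * v x) * ?d x \<partial>lebesgue_on \<Omega>) =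
      - (\<integral>x. ((a *\<^sub>R G x + b *\<^sub>R H x) \<bullet> e) * \<phi> x \<partial>lebesgue_on \<Omega>)" .
qed

lemma H1_lincomb:
  assumes u: "u \<in> H1 \<Omega>" and v: "v \<in> H1 \<Omega>"
  shows "(\<lambda>x. a * u x + b * v x) \<in> H1 \<Omega>"
    and "AE x in lebesgue_on \<Omega>. weak_gradient \<Omega> (\<lambda>x. a * u x + b * v x) x =
      a *\<^sub>R weak_gradient \<Omega> u x + b *\<^sub>R weak_gradient \<Omega> v x"
proof -
  have L2: "u \<in> L2 (lebesgue_on \<Omega>)" "v \<in> L2 (lebesgue_on \<Omega>)"
    using assms by (auto simp: H1_def)
  have grad: "is_weak_gradient \<Omega> (\<lambda>x. a * u x + b * v x)
      (\<lambda>x. a *\<^sub>R weak_gradient \<Omega> u x + b *\<^sub>R weak_gradient \<Omega> v x)"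
    using L2 u v by (intro is_weak_gradient_lincomb is_weak_gradient_weak_gradient)
  then show H1: "(\<lambda>x. a * u x + b * v x) \<in> H1 \<Omega>"
    using L2_lincomb[OF L2] by (auto simp: H1_def)
  from weak_gradient_eqI[OF this grad]
  show "AE x in lebesgue_on \<Omega>. weak_gradient \<Omega> (\<lambda>x. a * u x + b * v x) x =
      a *\<^sub>R weak_gradient \<Omega> u x + b *\<^sub>R weak_gradient \<Omega> v x" .
qed

lemma weak_gradient_inner_integrable:
  assumes "u \<in> H1 \<Omega>" and "v \<in> H1 \<Omega>"
  shows "integrable (lebesgue_on \<Omega>) (\<lambda>x. weak_gradient \<Omega> u x \<bullet> weak_gradient \<Omega> v x)"
proof -
  have "(\<lambda>x. weak_gradient \<Omega> w x \<bullet> b) \<in> L2 (lebesgue_on \<Omega>)" if "w \<in> H1 \<Omega>" "b \<in> Basis" for w b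
    using is_weak_gradient_weak_gradient[OF that(1)] that(2) by (auto simp: is_weak_gradient_def)
  then show ?thesis
    using assms by (subst euclidean_inner) (intro Bochner_Integration.integrable_sum L2_mult_integrable)
qed

lemma grad_inner_lincomb_left:
  assumes u: "u \<in> H1 \<Omega>" and v: "v \<in> H1 \<Omega>" and w: "w \<in> H1 \<Omega>"
  shows "grad_inner \<Omega> (\<lambda>x. a * u x + b * v x) w = a * grad_inner \<Omega> u w + b * grad_inner \<Omega> v w"
proof -
  let ?G = "weak_gradient \<Omega>"
  note int = weak_gradient_inner_integrable
  have "grad_inner \<Omega> (\<lambda>x. a * u x + b * v x) w =
      (\<integral>x. a * (?G u x \<bullet> ?G w x) + b * (?G v x \<bullet> ?G w x) \<partial>lebesgue_on \<Omega>)"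
    unfolding grad_inner_def
  proof (rule integral_cong_AE)
    show "AE x in lebesgue_on \<Omega>. ?G (\<lambda>x. a * u x + b * v x) x \<bullet> ?G w x =
        a * (?G u x \<bullet> ?G w x) + b * (?G v x \<bullet> ?G w x)"
      using H1_lincomb(2)[OF u v, of a b] by eventually_elim (simp add: inner_add_left)
    show "(\<lambda>x. ?G (\<lambda>x. a * u x + b * v x) x \<bullet> ?G w x) \<in> borel_measurable (lebesgue_on \<Omega>)"
      using int[OF H1_lincomb(1)[OF u v] w] by auto
    show "(\<lambda>x. a * (?G u x \<bullet> ?G w x) + b * (?G v x \<bullet> ?G w x)) \<in> borel_measurable (lebesgue_on \<Omega>)"
      using int[OF u w] int[OF v w] by auto
  qed
  also have "\<dots> = a * grad_inner \<Omega> u w + b * grad_inner \<Omega> v w"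
    unfolding grad_inner_def using int[OF u w] int[OF v w] by simp
  finally show ?thesis .
qed

lemma grad_inner_self_nonpos_iff:
  assumes "u \<in> H1 \<Omega>"
  shows "grad_inner \<Omega> u u \<le> 0 \<longleftrightarrow> (AE x in lebesgue_on \<Omega>. weak_gradient \<Omega> u x = 0)"
proof -
  have "grad_inner \<Omega> u u \<le> 0 \<longleftrightarrow> grad_inner \<Omega> u u = 0"
    by (auto simp: grad_inner_def intro: antisym integral_nonneg_AE)
  also have "\<dots> \<longleftrightarrow> (AE x in lebesgue_on \<Omega>. weak_gradient \<Omega> u x \<bullet> weak_gradient \<Omega> u x = 0)"
    unfolding grad_inner_def
    by (rule integral_nonneg_eq_0_iff_AE[OF weak_gradient_inner_integrable[OF assms assms]]) auto
  finally show ?thesis by simp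
qed

lemma grad_inner_zero_left:
  assumes u: "u \<in> H1 \<Omega>" and v: "v \<in> H1 \<Omega>" and "AE x in lebesgue_on \<Omega>. weak_gradient \<Omega> u x = 0"
  shows "grad_inner \<Omega> u v = 0"
proof -
  have "AE x in lebesgue_on \<Omega>. weak_gradient \<Omega> u x \<bullet> weak_gradient \<Omega> v x = 0"
    using assms(3) by eventually_elim simp
  then show ?thesis
    unfolding grad_inner_def by (rule integral_eq_zero_AE)
qed

lemma is_weak_gradient_cong_AE:
  assumes u: "u \<in> H1 \<Omega>" and v: "v \<in> borel_measurable (lebesgue_on \<Omega>)"
    and eq: "AE x in lebesgue_on \<Omega>. u x = v x"
    and G: "is_weak_gradient \<Omega> u G"
  shows "v \<in> H1 \<Omega>" and "is_weak_gradient \<Omega> v G"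
proof -
  have um: "u \<in> borel_measurable (lebesgue_on \<Omega>)" "integrable (lebesgue_on \<Omega>) (\<lambda>x. (u x)\<^sup>2)"
    using u by (auto simp: H1_def L2_def)
  have "AE x in lebesgue_on \<Omega>. (u x)\<^sup>2 = (v x)\<^sup>2" using eq by eventually_elim simp
  from integrable_cong_AE_imp[OF um(2) _ this] have "v \<in> L2 (lebesgue_on \<Omega>)"
    using v by (auto simp: L2_def)
  moreover show grad: "is_weak_gradient \<Omega> v G"
    unfolding is_weak_gradient_def
  proof (intro conjI ballI)
    fix b :: 'a assume b: "b \<in> Basis"
    show "(\<lambda>x. G x \<bullet> b) \<in> L2 (lebesgue_on \<Omega>)" using G b by (auto simp: is_weak_gradient_def)
    fix \<phi> assume \<phi>: "\<phi> \<in> test_functions \<Omega>"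
    have dm: "(\<lambda>x. frechet_derivative \<phi> (at x) b) \<in> borel_measurable (lebesgue_on \<Omega>)"
      using test_function_derivative[OF \<phi> b] by (rule test_function_measurable_on)
    have "(\<integral>x. v x * frechet_derivative \<phi> (at x) b \<partial>lebesgue_on \<Omega>) =
        (\<integral>x. u x * frechet_derivative \<phi> (at x) b \<partial>lebesgue_on \<Omega>)"
    proof (rule integral_cong_AE)
      show "AE x in lebesgue_on \<Omega>. v x * frechet_derivative \<phi> (at x) b = u x * frechet_derivative \<phi> (at x) b"
        using eq by eventually_elim simp
    qed (use um v dm in auto)
    also have "\<dots> = - (\<integral>x. (G x \<bullet> b) * \<phi> x \<partial>lebesgue_on \<Omega>)"
      using G \<phi> b unfolding is_weak_gradient_def by blast
    finally show "(\<integral>x. v x * frechet_derivative \<phi> (at x) b \<partial>lebesgue_on \<Omega>) =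
        - (\<integral>x. (G x \<bullet> b) * \<phi> x \<partial>lebesgue_on \<Omega>)" .
  qed
  ultimately show "v \<in> H1 \<Omega>" by (auto simp: H1_def)
qed

lemma H1_zero_gradient_imp_constant:
  assumes "connected \<Omega>" and u: "u \<in> H1 \<Omega>"
    and grad: "AE x in lebesgue_on \<Omega>. weak_gradient \<Omega> u x = 0"
  obtains c where "AE x in lebesgue_on \<Omega>. u x = c"
proof -
  have "integrable (lebesgue_on \<Omega>) u"
    using u by (intro L2_domain_integrable) (simp add: H1_def)
  then obtain h where h: "integrable lborel h" "AE x in lebesgue_on \<Omega>. u x = h x"
    "\<forall>\<phi>\<in>borel_measurable borel.
      (\<integral>x. u x * \<phi> x \<partial>lebesgue_on \<Omega>) = (\<integral>x. h x * \<phi> x \<partial>lborel)"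
    by (rule integrable_lebesgue_on_borel_representative[OF open_domain])
  have "(\<integral>x. h x * frechet_derivative \<phi> (at x) b \<partial>lborel) = 0"
    if \<phi>: "\<phi> \<in> test_functions \<Omega>" and b: "b \<in> Basis" for \<phi> b
  proof -
    have "(\<integral>x. h x * frechet_derivative \<phi> (at x) b \<partial>lborel) =
        (\<integral>x. u x * frechet_derivative \<phi> (at x) b \<partial>lebesgue_on \<Omega>)"
      using h(3)[rule_format, OF test_function_measurable[OF test_function_derivative[OF that]]] by simp
    also have "\<dots> = - (\<integral>x. (weak_gradient \<Omega> u x \<bullet> b) * \<phi> x \<partial>lebesgue_on \<Omega>)"
      using is_weak_gradient_weak_gradient[OF u] that unfolding is_weak_gradient_def by blast
    also have "(\<integral>x. (weak_gradient \<Omega> u x \<bullet> b) * \<phi> x \<partial>lebesgue_on \<Omega>) = 0"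
      by (rule integral_eq_zero_AE) (use grad in \<open>eventually_elim, simp\<close>)
    finally show ?thesis by simp
  qed
  then obtain c where "AE x in lebesgue. x \<in> \<Omega> \<longrightarrow> h x = c"
    using zero_weak_gradient_constant[OF open_domain assms(1) h(1)] by blast
  then have "AE x in lebesgue_on \<Omega>. h x = c"
    using open_domain by (simp add: AE_restrict_space_iff)
  with h(2) have "AE x in lebesgue_on \<Omega>. u x = c" by eventually_elim simp
  then show ?thesis by (rule that)
qed

lemma H1_AE_zero_norm:
  assumes u: "u \<in> H1 \<Omega>" and zero: "AE x in lebesgue_on \<Omega>. u x = 0"
  shows "H1_norm \<Omega> u = 0"
proof -
  have grad0: "is_weak_gradient \<Omega> (\<lambda>x. 0) (\<lambda>x. 0)"
    by (simp add: is_weak_gradient_def L2_def)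
  then have H0: "(\<lambda>x. 0) \<in> H1 \<Omega>"
    by (auto simp: H1_def L2_def)
  have "u \<in> borel_measurable (lebesgue_on \<Omega>)"
    using u by (simp add: H1_def L2_def)
  moreover have "AE x in lebesgue_on \<Omega>. 0 = u x"
    using zero by eventually_elim simp
  ultimately have "is_weak_gradient \<Omega> u (\<lambda>x. 0)"
    by (rule is_weak_gradient_cong_AE(2)[OF H0 _ _ grad0])
  then have "AE x in lebesgue_on \<Omega>. weak_gradient \<Omega> u x = 0"
    by (rule weak_gradient_eqI[OF u])
  then have "grad_inner \<Omega> u u = 0" by (rule grad_inner_zero_left[OF u u])
  moreover have "(\<integral>x. (u x)\<^sup>2 \<partial>lebesgue_on \<Omega>) = 0"
    by (rule integral_eq_zero_AE) (use zero in \<open>eventually_elim, simp\<close>)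
  ultimately show ?thesis by (simp add: H1_norm_def)
qed

end

section \<open>Traces and the space of admissible functions\<close>

lemma AE_boundary_on_subset:
  assumes "AE x in boundary_on B. P x" and "A \<subseteq> B" and "A \<in> sets length_measure" and "B \<in> sets length_measure"
  shows "AE x in boundary_on A. P x"
proof -
  have "AE x in length_measure. x \<in> B \<longrightarrow> P x"
    using assms(1,4) unfolding boundary_on_def by (subst (asm) AE_restrict_space_iff) auto
  then have "AE x in length_measure. x \<in> A \<longrightarrow> P x"
    by (rule eventually_mono) (use assms(2) in blast)
  then show ?thesis
    using assms(3) unfolding boundary_on_def by (subst AE_restrict_space_iff) auto
qed

context
  fixes \<Omega> :: "(real^2) set" and \<gamma>
  assumes domain: "smooth_bounded_domain \<Omega>" and trace: "trace_operator \<Omega> \<gamma>"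
begin

lemma open_smooth_domain: "open \<Omega>" and bounded_smooth_domain: "bounded \<Omega>"
  and connected_smooth_domain: "connected \<Omega>"
  using domain by (auto simp: smooth_bounded_domain_def)

lemma trace_lincomb:
  "u \<in> H1 \<Omega> \<Longrightarrow> v \<in> H1 \<Omega> \<Longrightarrow>
    AE x in boundary_on (frontier \<Omega>). \<gamma> (\<lambda>y. a * u y + b * v y) x = a * \<gamma> u x + b * \<gamma> v x"
  using trace unfolding trace_operator_def by blast

text \<open>
  Boundedness of the trace operator forces this: the Sobolev norm of such a function is zero.
\<close>

lemma trace_AE_zero:
  assumes u: "u \<in> H1 \<Omega>" and zero: "AE x in lebesgue_on \<Omega>. u x = 0"
  shows "AE x in boundary_on (frontier \<Omega>). \<gamma> u x = 0"
proof -
  let ?M = "boundary_on (frontier \<Omega>)"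
  obtain C where "L2_norm ?M (\<gamma> u) \<le> C * H1_norm \<Omega> u"
    using trace u unfolding trace_operator_def by blast
  then have "(\<integral>x. (\<gamma> u x)\<^sup>2 \<partial>?M) \<le> 0"
    using H1_AE_zero_norm[OF open_smooth_domain bounded_smooth_domain u zero]
    by (simp add: L2_norm_def)
  then have "(\<integral>x. (\<gamma> u x)\<^sup>2 \<partial>?M) = 0"
    by (intro antisym integral_nonneg_AE) auto
  moreover have "integrable ?M (\<lambda>x. (\<gamma> u x)\<^sup>2)"
    using trace u unfolding trace_operator_def L2_def by blast
  ultimately have "AE x in ?M. (\<gamma> u x)\<^sup>2 = 0"
    by (subst integral_nonneg_eq_0_iff_AE[symmetric]) auto
  then show ?thesis by simp
qed

text \<open>
  Definiteness of the inner product. The function equals a constant a.e. on the connected domain, so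
  its trace is that constant a.e. on the whole boundary; since the trace vanishes on a part of
  positive length, the constant is zero.
\<close>

lemma space_X_zero_gradient_imp_zero:
  assumes u: "u \<in> space_X \<Omega> \<gamma> A"
    and A: "A \<subseteq> frontier \<Omega>" "A \<in> sets length_measure" "emeasure length_measure A > 0"
    and frontier: "frontier \<Omega> \<in> sets length_measure"
    and grad: "AE x in lebesgue_on \<Omega>. weak_gradient \<Omega> u x = 0"
  shows "AE x in lebesgue_on \<Omega>. u x = 0"
proof -
  note dom = open_smooth_domain bounded_smooth_domain
  let ?M = "boundary_on (frontier \<Omega>)"
  have uH: "u \<in> H1 \<Omega>" and u0: "AE x in boundary_on A. \<gamma> u x = 0"
    using u by (auto simp: space_X_def)
  obtain c where c: "AE x in lebesgue_on \<Omega>. u x = c"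
    using H1_zero_gradient_imp_constant[OF dom connected_smooth_domain uH grad] .
  \<comment> \<open>A weak gradient of \<open>u\<close> is one of the constant as well, since both agree a.e.\<close>
  have constH: "(\<lambda>x. c) \<in> H1 \<Omega>"
    by (rule is_weak_gradient_cong_AE(1)[OF dom uH _ c is_weak_gradient_weak_gradient[OF dom uH]]) simp
  have "AE x in ?M. \<gamma> (\<lambda>x. 1 * u x + (- 1) * c) x = 0"
    by (rule trace_AE_zero[OF H1_lincomb(1)[OF dom uH constH]]) (use c in \<open>eventually_elim, simp\<close>)
  moreover have "AE x in ?M. \<gamma> (\<lambda>x. 1 * u x + (- 1) * c) x = 1 * \<gamma> u x + (- 1) * \<gamma> (\<lambda>x. c) x"
    using uH constH by (rule trace_lincomb)
  moreover have "AE x in ?M. \<gamma> (\<lambda>x. c) x = c"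
    using trace constH continuous_on_const[of "closure \<Omega>" c] unfolding trace_operator_def by blast
  ultimately have "AE x in ?M. \<gamma> u x = c" by eventually_elim simp
  then have "AE x in boundary_on A. \<gamma> u x = c"
    using A(1,2) frontier by (rule AE_boundary_on_subset)
  with u0 have "AE x in boundary_on A. c = 0" by eventually_elim simp
  then have "AE x in length_measure. x \<in> A \<longrightarrow> c = 0"
    using A(2) unfolding boundary_on_def by (subst (asm) AE_restrict_space_iff) auto
  have "c = 0"
  proof (rule ccontr)
    assume "c \<noteq> 0"
    with \<open>AE x in length_measure. x \<in> A \<longrightarrow> c = 0\<close> have "AE x in length_measure. x \<notin> A" by simp
    then have "A \<in> null_sets length_measure" using A(2) by (simp add: AE_iff_null_sets)
    then show False using A(3) by (simp add: null_sets_def)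
  qed
  then show ?thesis using c by simp
qed

lemma space_X_lincomb:
  assumes u: "u \<in> space_X \<Omega> \<gamma> A" and v: "v \<in> space_X \<Omega> \<gamma> A"
    and A: "A \<subseteq> frontier \<Omega>" "A \<in> sets length_measure" "frontier \<Omega> \<in> sets length_measure"
  shows "(\<lambda>x. a * u x + b * v x) \<in> space_X \<Omega> \<gamma> A"
proof -
  have H: "u \<in> H1 \<Omega>" "v \<in> H1 \<Omega>" using u v by (auto simp: space_X_def)
  have "AE x in boundary_on A. \<gamma> (\<lambda>y. a * u y + b * v y) x = a * \<gamma> u x + b * \<gamma> v x"
    using trace_lincomb[OF H] A by (rule AE_boundary_on_subset)
  moreover have "AE x in boundary_on A. \<gamma> u x = 0" "AE x in boundary_on A. \<gamma> v x = 0"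
    using u v by (auto simp: space_X_def)
  ultimately have "AE x in boundary_on A. \<gamma> (\<lambda>y. a * u y + b * v y) x = 0"
    by eventually_elim simp
  then show ?thesis
    using H1_lincomb(1)[OF open_smooth_domain bounded_smooth_domain H] by (simp add: space_X_def)
qed

lemma func_j_scale:
  assumes v: "v \<in> H1 \<Omega>" and t: "0 \<le> t"
    and A: "A \<subseteq> frontier \<Omega>" "A \<in> sets length_measure" "frontier \<Omega> \<in> sets length_measure"
  shows "func_j \<gamma> A g (\<lambda>x. t * v x) = t * func_j \<gamma> A g v"
proof -
  have tv: "(\<lambda>x. t * v x) \<in> H1 \<Omega>"
    using H1_lincomb(1)[OF open_smooth_domain bounded_smooth_domain v v, of t 0] by simp
  have meas: "\<gamma> w \<in> borel_measurable (boundary_on A)" if "w \<in> H1 \<Omega>" for w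
  proof -
    have "\<gamma> w \<in> borel_measurable (boundary_on (frontier \<Omega>))"
      using trace that by (auto simp: trace_operator_def L2_def)
    then show ?thesis
      using A(1) unfolding boundary_on_def by (rule measurable_restrict_mono)
  qed
  have "AE x in boundary_on A. \<gamma> (\<lambda>y. t * v y + 0 * v y) x = t * \<gamma> v x + 0 * \<gamma> v x"
    using trace_lincomb[OF v v] A by (rule AE_boundary_on_subset)
  then have eq: "AE x in boundary_on A. g * \<bar>\<gamma> (\<lambda>y. t * v y) x\<bar> = t * (g * \<bar>\<gamma> v x\<bar>)"
    by eventually_elim (simp add: abs_mult t)
  have "func_j \<gamma> A g (\<lambda>x. t * v x) = (\<integral>x. t * (g * \<bar>\<gamma> v x\<bar>) \<partial>boundary_on A)"
    unfolding func_j_def using meas[OF tv] meas[OF v] eq by (intro integral_cong_AE) auto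
  then show ?thesis by (simp add: func_j_def)
qed

end

section \<open>The mixed problem and the variational inequality\<close>

text \<open>
  The inequality compares a linear functional with a positively homogeneous one. Testing it with
  $0$ and $2u$ forces equality of both at \<open>u\<close>; with that, the inequality for a general \<open>v\<close> becomes
  the condition that defines the set of multipliers.
\<close>

lemma variational_multiplier:
  fixes \<Omega> :: "(real^2) set"
  assumes domain: "smooth_bounded_domain \<Omega>" and trace: "trace_operator \<Omega> \<gamma>"
    and parts: "boundary_partition (frontier \<Omega>) \<Gamma>\<^sub>1 \<Gamma>\<^sub>2 \<Gamma>\<^sub>3"
    and u: "u \<in> space_X \<Omega> \<gamma> \<Gamma>\<^sub>1" and l: "l \<in> dual_X \<Omega> \<gamma> \<Gamma>\<^sub>1"
    and ineq: "\<And>v. v \<in> space_X \<Omega> \<gamma> \<Gamma>\<^sub>1 \<Longrightarrow> l (v - u) \<le> func_j \<gamma> \<Gamma>\<^sub>3 g v - func_j \<gamma> \<Gamma>\<^sub>3 g u"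
  shows "l u = func_j \<gamma> \<Gamma>\<^sub>3 g u" and "l \<in> Lambda_bar \<Omega> \<gamma> \<Gamma>\<^sub>1 \<Gamma>\<^sub>3 g"
proof -
  let ?X = "space_X \<Omega> \<gamma> \<Gamma>\<^sub>1" and ?j = "func_j \<gamma> \<Gamma>\<^sub>3 g"
  have \<Gamma>1: "\<Gamma>\<^sub>1 \<subseteq> frontier \<Omega>" "\<Gamma>\<^sub>1 \<in> sets length_measure"
    and \<Gamma>3: "\<Gamma>\<^sub>3 \<subseteq> frontier \<Omega>" "\<Gamma>\<^sub>3 \<in> sets length_measure"
    and frontier: "frontier \<Omega> \<in> sets length_measure"
    using parts by (auto simp: boundary_partition_def)
  have lin: "l (\<lambda>x. a * v x + b * w x) = a * l v + b * l w" if "v \<in> ?X" "w \<in> ?X" for v w a b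
    using l that by (auto simp: dual_X_def)
  have test: "t * l v - l u \<le> t * ?j v - ?j u" if v: "v \<in> ?X" and t: "0 \<le> t" for v t
  proof -
    have "(\<lambda>x. t * v x) \<in> ?X"
      using space_X_lincomb[OF domain trace v v \<Gamma>1 frontier, of t 0] by simp
    from ineq[OF this] have "l (\<lambda>x. t * v x + (- 1) * u x) \<le> ?j (\<lambda>x. t * v x) - ?j u"
      by (simp add: fun_diff_def)
    then show ?thesis
      using lin[OF v u, of t "- 1"] func_j_scale[OF domain trace _ t \<Gamma>3 frontier, of v] v
      by (simp add: space_X_def)
  qed
  show eq: "l u = ?j u"
    using test[OF u, of 0] test[OF u, of 2] by simp
  have "l v \<le> ?j v" if "v \<in> ?X" for v
    using test[OF that, of 1] eq by simp
  then show "l \<in> Lambda_bar \<Omega> \<gamma> \<Gamma>\<^sub>1 \<Gamma>\<^sub>3 g"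
    using l by (simp add: Lambda_bar_def func_j_def)
qed

theorem theorem5:
  fixes \<Omega> \<Gamma>\<^sub>1 \<Gamma>\<^sub>2 \<Gamma>\<^sub>3 :: "(real^2) set"
    and \<gamma> :: "(real^2 \<Rightarrow> real) \<Rightarrow> (real^2 \<Rightarrow> real)"
    and g \<xi> :: real
    and f\<^sub>0 f\<^sub>2 f u u\<^sub>0 :: "real^2 \<Rightarrow> real"
    and l l\<^sub>0 :: "(real^2 \<Rightarrow> real) \<Rightarrow> real"
  defines "X \<equiv> space_X \<Omega> \<gamma> \<Gamma>\<^sub>1"
    and "a \<equiv> form_a \<Omega> \<xi>"
    and "j \<equiv> func_j \<gamma> \<Gamma>\<^sub>3 g"
    and "\<Lambda> \<equiv> Lambda_bar \<Omega> \<gamma> \<Gamma>\<^sub>1 \<Gamma>\<^sub>3 g"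
  assumes domain: "smooth_bounded_domain \<Omega>"
    and parts: "boundary_partition (frontier \<Omega>) \<Gamma>\<^sub>1 \<Gamma>\<^sub>2 \<Gamma>\<^sub>3"
    and trace: "trace_operator \<Omega> \<gamma>"
    and constants: "g > 0" "\<xi> > 0"
    and data: "f\<^sub>0 \<in> L2 (lebesgue_on \<Omega>)" "f\<^sub>2 \<in> L2 (boundary_on \<Gamma>\<^sub>2)"
    and f: "f \<in> X"
      "\<forall>v\<in>X. grad_inner \<Omega> f v =
         (\<integral>x. f\<^sub>0 x * v x \<partial>lebesgue_on \<Omega>) + (\<integral>x. f\<^sub>2 x * \<gamma> v x \<partial>boundary_on \<Gamma>\<^sub>2)"
    and mixed: "u \<in> X" "l \<in> \<Lambda>"
      "\<forall>v\<in>X. a u v + l v = grad_inner \<Omega> f v"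
      "\<forall>\<mu>\<in>\<Lambda>. (\<mu> - l) u \<le> 0"
    and variational: "u\<^sub>0 \<in> X"
      "\<forall>v\<in>X. a u\<^sub>0 (v - u\<^sub>0) + j v - j u\<^sub>0 \<ge> grad_inner \<Omega> f (v - u\<^sub>0)"
    and multiplier: "l\<^sub>0 \<in> dual_X \<Omega> \<gamma> \<Gamma>\<^sub>1"
      "\<forall>v\<in>X. l\<^sub>0 v = grad_inner \<Omega> f v - a u\<^sub>0 v"
  shows "(AE x in lebesgue_on \<Omega>. u x = u\<^sub>0 x) \<and> (\<forall>v\<in>X. l v = l\<^sub>0 v)"
proof -
  have dom: "open \<Omega>" "bounded \<Omega>"
    using domain by (auto simp: smooth_bounded_domain_def)
  have \<Gamma>1: "\<Gamma>\<^sub>1 \<subseteq> frontier \<Omega>" "\<Gamma>\<^sub>1 \<in> sets length_measure" "emeasure length_measure \<Gamma>\<^sub>1 > 0"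
    and frontier: "frontier \<Omega> \<in> sets length_measure"
    using parts by (auto simp: boundary_partition_def)
  have XH: "v \<in> X \<Longrightarrow> v \<in> H1 \<Omega>" for v by (simp add: X_def space_X_def)
  have X_diff: "v - w \<in> X" if "v \<in> X" "w \<in> X" for v w
    using space_X_lincomb[OF domain trace that[unfolded X_def] \<Gamma>1(1,2) frontier, of 1 "- 1"]
    by (simp add: X_def fun_diff_def)
  have "l\<^sub>0 (v - u\<^sub>0) \<le> j v - j u\<^sub>0" if "v \<in> X" for v
    using variational that multiplier(2)[rule_format, OF X_diff[OF that variational(1)]] by force
  from variational_multiplier[OF domain trace parts variational(1)[unfolded X_def] multiplier(1)
      this[unfolded X_def j_def]]
  have l0_u0: "l\<^sub>0 u\<^sub>0 = j u\<^sub>0" and l0: "l\<^sub>0 \<in> \<Lambda>" by (simp_all add: j_def \<Lambda>_def)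
  define w where "w = u - u\<^sub>0"
  have w: "w \<in> X" unfolding w_def using mixed(1) variational(1) by (rule X_diff)
  have a_w: "a w v = l\<^sub>0 v - l v" if v: "v \<in> X" for v
  proof -
    have "a w v = a u v - a u\<^sub>0 v"
      using grad_inner_lincomb_left[OF dom XH[OF mixed(1)] XH[OF variational(1)] XH[OF v], of 1 "- 1"]
      by (simp add: a_def form_a_def w_def fun_diff_def right_diff_distrib)
    then show ?thesis using mixed(3) multiplier(2) v by force
  qed
  have lin: "k w = k u - k u\<^sub>0" if "k \<in> dual_X \<Omega> \<gamma> \<Gamma>\<^sub>1" for k
  proof -
    have "k (\<lambda>x. 1 * u x + (- 1) * u\<^sub>0 x) = 1 * k u + (- 1) * k u\<^sub>0"
      using that mixed(1) variational(1) unfolding dual_X_def X_def by blast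
    then show ?thesis by (simp add: w_def fun_diff_def)
  qed
  \<comment> \<open>Both brackets are nonpositive: the first because \<open>l\<^sub>0\<close> is an admissible multiplier in the mixed problem,
    the second because \<open>l\<close> is dominated by \<open>j\<close>, which
    \<open>l\<^sub>0\<close> attains at \<open>u\<^sub>0\<close>.\<close>
  have "a w w = (l\<^sub>0 u - l u) + (l u\<^sub>0 - l\<^sub>0 u\<^sub>0)"
    using a_w[OF w] lin[OF multiplier(1)] lin[of l] mixed(2) by (simp add: \<Lambda>_def Lambda_bar_def)
  also have "\<dots> \<le> 0"
  proof -
    have "l\<^sub>0 u - l u \<le> 0" using mixed(4) l0 by auto
    moreover have "l u\<^sub>0 \<le> j u\<^sub>0"
      using mixed(2) variational(1) by (simp add: \<Lambda>_def Lambda_bar_def j_def func_j_def X_def)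
    ultimately show ?thesis using l0_u0 by simp
  qed
  finally have "grad_inner \<Omega> w w \<le> 0"
    using constants(2) by (simp add: a_def form_a_def mult_le_0_iff)
  then have grad: "AE x in lebesgue_on \<Omega>. weak_gradient \<Omega> w x = 0"
    using grad_inner_self_nonpos_iff[OF dom XH[OF w]] by simp
  have "AE x in lebesgue_on \<Omega>. w x = 0"
    using space_X_zero_gradient_imp_zero[OF domain trace w[unfolded X_def] \<Gamma>1 frontier grad] .
  then have "AE x in lebesgue_on \<Omega>. u x = u\<^sub>0 x" by (simp add: w_def)
  moreover have "l v = l\<^sub>0 v" if "v \<in> X" for v
    using a_w[OF that] grad_inner_zero_left[OF dom XH[OF w] XH[OF that] grad]
    by (simp add: a_def form_a_def)
  ultimately show ?thesis by blast
qed

end
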